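(* Let $p,q\in(0,1)$ with $(p,q)\neq(\tfrac12,\tfrac12)$, and let $\omega$ be corner percolation on $\mathbb Z^2$ with parameters $(p,q)$. Then $\omega$ has indistinguishable infinite clusters: for every component property $\mathscr A$, the event $\{(\omega,o)\in\mathscr A\}$ has probability either $0$ or $1$ conditionally on the cluster of the origin $o=(0,0)$ being infinite.
   Context: **Corner percolation.** Consider $\mathbb Z^2$ with its nearest-neighbour edges. A vertex $(x,y)$ is even if $x+y$ is even and odd otherwise. Let $(\xi_k)_{k\in\mathbb Z}$ be i.i.d. with $\mathbb P(\xi_0=1)=p$, $\mathbb P(\xi_0=-1)=1-p$, and, independently, let $(\eta_k)_{k\in\mathbb Z}$ be i.i.d. with $\mathbb P(\eta_0=1)=q$, $\mathbb P(\eta_0=-1)=1-q$. The configuration $\omega$ is the random set of open edges defined by: - the vertical edge $\{(x,y),(x,y+1)\}$ is open if and only if either $(x,y)$ is odd and $\xi_x=1$, or $(x,y)$ is even and $\xi_x=-1$; - the horizontal edge $\{(x,y),(x+1,y)\}$ is open if and only if either $(x,y)$ is odd and $\eta_y=1$, or $(x,y)$ is even and $\eta_y=-1$. Clusters are the connected components of the graph of open edges. (Every vertex has exactly one open vertical and one open horizontal edge. For $(p,q)\ne(\tfrac12,\tfrac12)$ it is known that almost surely there are infinitely many infinite clusters, each a bi-infinite path.) **Component property.** A measurable set $\mathscr A$ of pairs $(\omega,v)$ (a configuration and a vertex of $\mathbb Z^2$) that is invariant under the diagonal action of translations of $\mathbb Z^2$ and such that, for $v,w$ in the same cluster of $\omega$,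 $(\omega,v)\in\mathscr A$ iff $(\omega,w)\in\mathscr A$. *)

theory Defs
  imports "HOL-Probability.Probability"
begin

type_synonym vertex = "int \<times> int"
type_synonym edge = "vertex set"

(* A configuration is a function on lattice_edges, True meaning open; as an element of a
   PiM space it takes the value undefined off lattice_edges. *)
type_synonym config = "edge \<Rightarrow> bool"

definition lattice_edges :: "edge set" where
  "lattice_edges =
     {{(x, y), (x, y + 1)} | x y. True} \<union> {{(x, y), (x + 1, y)} | x y. True}"

definition config_space :: "config measure" where
  "config_space = (\<Pi>\<^sub>M e\<in>lattice_edges. count_space UNIV)"

definition open_adj :: "config \<Rightarrow> (vertex \<times> vertex) set" where
  "open_adj \<omega> = {(u, v). {u, v} \<in> lattice_edges \<and> \<omega> {u, v}}"

definition cluster :: "config \<Rightarrow> vertex \<Rightarrow> vertex set" where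
  "cluster \<omega> v = {w. (v, w) \<in> (open_adj \<omega>)\<^sup>*}"

(* The edge e + t is open in translate t \<omega> iff e is open in \<omega>. *)
definition translate :: "vertex \<Rightarrow> config \<Rightarrow> config" where
  "translate t \<omega> = (\<lambda>e\<in>lattice_edges. \<omega> ((\<lambda>v. v - t) ` e))"

(* Invariance is under all translations, including the parity-reversing ones, under which
   the law of corner percolation itself is not invariant. *)
definition component_property :: "(config \<times> vertex) set \<Rightarrow> bool" where
  "component_property A \<longleftrightarrow>
     A \<in> sets (config_space \<Otimes>\<^sub>M count_space UNIV) \<and>
     (\<forall>\<omega>\<in>space config_space. \<forall>v t. (translate t \<omega>, v + t) \<in> A \<longleftrightarrow> (\<omega>, v) \<in> A) \<and>
     (\<forall>\<omega>\<in>space config_space. \<forall>v. \<forall>w\<in>cluster \<omega> v. (\<omega>, v) \<in> A \<longleftrightarrow> (\<omega>, w) \<in> A)"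

definition corner_config :: "(int \<Rightarrow> int) \<Rightarrow> (int \<Rightarrow> int) \<Rightarrow> config" where
  "corner_config \<xi> \<eta> = (\<lambda>e\<in>lattice_edges.
     (\<exists>x y. e = {(x, y), (x, y + 1)} \<and>
        (odd (x + y) \<and> \<xi> x = 1 \<or> even (x + y) \<and> \<xi> x = -1)) \<or>
     (\<exists>x y. e = {(x, y), (x + 1, y)} \<and>
        (odd (x + y) \<and> \<eta> y = 1 \<or> even (x + y) \<and> \<eta> y = -1)))"

(* The signs are +1 or -1 only almost surely. *)
locale corner_percolation = prob_space M
  for M :: "'s measure" and p q :: real and \<xi> \<eta> :: "int \<Rightarrow> 's \<Rightarrow> int" +
  assumes indep_xi: "indep_vars (\<lambda>_. count_space UNIV) \<xi> UNIV"
    and indep_eta: "indep_vars (\<lambda>_. count_space UNIV) \<eta> UNIV"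
    and indep_xi_eta:
      "indep_var (\<Pi>\<^sub>M k\<in>UNIV. count_space UNIV) (\<lambda>s k. \<xi> k s)
                 (\<Pi>\<^sub>M k\<in>UNIV. count_space UNIV) (\<lambda>s k. \<eta> k s)"
    and prob_xi: "prob {s \<in> space M. \<xi> k s = 1} = p" "prob {s \<in> space M. \<xi> k s = -1} = 1 - p"
    and prob_eta: "prob {s \<in> space M. \<eta> k s = 1} = q" "prob {s \<in> space M. \<eta> k s = -1} = 1 - q"

(* cond_prob is 0 when the conditioning event is null. *)
definition indistinguishable_infinite_clusters ::
    "'s measure \<Rightarrow> ('s \<Rightarrow> config) \<Rightarrow> bool" where
  "indistinguishable_infinite_clusters M X \<longleftrightarrow>
     (\<forall>A. component_property A \<longrightarrow>
        \<P>(s in M. (X s, (0, 0)) \<in> A \<bar> infinite (cluster (X s) (0, 0))) \<in> {0, 1})"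

end

theory Submission
  imports Defs
begin

text \<open>
Let \<open>S\<close> and \<open>R\<close> be the walks with increments \<open>\<xi>\<close> and \<open>\<eta>\<close>. A cluster is a level line of the height
function \<open>S\<^sub>x + R\<^sub>y\<close>, traversed by the map \<open>step\<close>, so a component property is a function of the signs
that is invariant under recentring along this line. By symmetry \<open>S\<close> drifts to \<open>+\<infinity>\<close>, and then it has
infinitely many cuts: columns \<open>x\<close> with \<open>S\<^sub>z \<le> S\<^sub>x\<close> for \<open>z \<le> x\<close> and \<open>S\<^sub>z > S\<^sub>x\<close> for \<open>z > x\<close>. In a row where
a level is attained at a cut, the cut is the only place where lines of that level pass, and they pass
upwards. Hence all cut vertices of one level lie on the same
line, and every line through the origin that is not a closed loop contains a cut vertex.

Approximate an invariant event by a local one. By mass transport along the level of the origin, the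
approximation is also good at the cut vertices in a far row. A permutation of finitely many rows
does not change these vertices or their surroundings, so at a cut the event is invariant under it;
mixing of the i.i.d. signs \<open>\<eta>\<close> then makes the event depend on \<open>\<xi>\<close> only. Two cuts of \<open>\<xi>\<close> are joined by
a level line for a set of \<open>\<eta>\<close> of positive probability, so the answer is the same at all cuts of
\<open>\<xi>\<close>, and mixing of the shift on \<open>\<xi>\<close> makes it constant.
\<close>

section \<open>The path through a vertex and its level\<close>

text \<open>The obstacle is that the cut vertices on the line of the origin are selected by the
  signs themselves: the environment around them need not have the law of the signs, and a local
  approximation that is good at the origin may fail there. What helps is that a row and a level
  determine at most one last visit of the walk, a column after which \<open>walk \<xi>\<close> stays
  strictly higher. Pairing the last visits of one level in two rows is injective and commutes with
  translations, so an event of small probability is rarely met at the partner, uniformly in the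
  distance of the rows. Last visits carry the transport, and not cuts, because a drifting walk has
  one at every height, whereas a given row may have no cut at the prescribed height; a bounded
  number of further rows then provides a cut with high probability. Rows are permuted and not
  translated, since a permutation of the signs with indices \<open>0, ..., y - 1\<close> preserves
  \<open>walk \<eta> y\<close>, and with it the levels of the cut vertices in row
  \<open>y\<close>.\<close>

definition pm :: "(int \<Rightarrow> int) \<Rightarrow> bool" where
  "pm f \<longleftrightarrow> (\<forall>k. f k = 1 \<or> f k = -1)"

definition shift :: "int \<Rightarrow> (int \<Rightarrow> 'a) \<Rightarrow> int \<Rightarrow> 'a" where
  "shift t f = (\<lambda>k. f (k + t))"

text \<open>One of the two intervals is always empty; the second sum extends the walk to the left of
  \<open>0\<close>, so that \<open>f x\<close> is the increment from \<open>x\<close> to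
  \<open>x + 1\<close> for every integer \<open>x\<close>.\<close>

definition walk :: "(int \<Rightarrow> int) \<Rightarrow> int \<Rightarrow> int" where
  "walk f x = (\<Sum>i\<in>{0..<x}. f i) - (\<Sum>i\<in>{x..<0}. f i)"

lemma walk_0 [simp]: "walk f 0 = 0"
  by (simp add: walk_def)

lemma walk_Suc: "walk f (x + 1) = walk f x + f x"
proof (cases "x \<ge> 0")
  case True
  then have "{0..<x + 1} = insert x {0..<x}" by auto
  with True show ?thesis by (simp add: walk_def)
next
  case False
  then have "{x..<0} = insert x {x + 1..<0}" by auto
  with False show ?thesis by (simp add: walk_def)
qed

lemma walk_pred: "walk f (x - 1) = walk f x - f (x - 1)"
  using walk_Suc[of f "x - 1"] by simp

lemma shift_shift [simp]: "shift a (shift b f) = shift (a + b) f"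
  by (simp add: shift_def add.assoc)

lemma shift_0 [simp]: "shift 0 f = f"
  by (simp add: shift_def)

lemma pm_shift [simp]: "pm f \<Longrightarrow> pm (shift t f)"
  by (simp add: pm_def shift_def)

lemma walk_shift: "walk (shift t f) x = walk f (x + t) - walk f t"
proof (induction x rule: int_induct[where k = 0])
  case base
  show ?case by simp
next
  case (step1 i)
  then show ?case
    using walk_Suc[of f "i + t"] walk_Suc[of "shift t f" i] by (simp add: shift_def algebra_simps)
next
  case (step2 i)
  then show ?case
    using walk_pred[of f "i + t"] walk_pred[of "shift t f" i] by (simp add: shift_def algebra_simps)
qed

lemma walk_step_abs: "pm f \<Longrightarrow> \<bar>walk f (x + 1) - walk f x\<bar> \<le> 1"
  unfolding walk_Suc pm_def by (metis abs_minus abs_one add_diff_cancel_left' order_refl)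

text \<open>From an even vertex, \<open>step\<close> follows the open horizontal edge and then the open vertical edge. As a
  map on all of \<open>\<int> \<times> \<int>\<close> it commutes with every translation of the signs, so parity plays no role.\<close>

definition step :: "(int \<Rightarrow> int) \<Rightarrow> (int \<Rightarrow> int) \<Rightarrow> vertex \<Rightarrow> vertex" where
  "step \<xi> \<eta> = (\<lambda>(x, y). (x - \<eta> y, y + \<xi> (x - \<eta> y)))"

definition unstep :: "(int \<Rightarrow> int) \<Rightarrow> (int \<Rightarrow> int) \<Rightarrow> vertex \<Rightarrow> vertex" where
  "unstep \<xi> \<eta> = (\<lambda>(x, y). (x + \<eta> (y - \<xi> x), y - \<xi> x))"

lemma unstep_step [simp]: "unstep \<xi> \<eta> (step \<xi> \<eta> v) = v"
  by (cases v) (simp add: step_def unstep_def)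

lemma step_unstep [simp]: "step \<xi> \<eta> (unstep \<xi> \<eta> v) = v"
  by (cases v) (simp add: step_def unstep_def)

lemma inj_step: "inj (step \<xi> \<eta>)"
  by (metis injI unstep_step)

lemma step_shift: "step (shift a \<xi>) (shift b \<eta>) v + (a, b) = step \<xi> \<eta> (v + (a, b))"
  by (cases v) (simp add: step_def shift_def algebra_simps)

text \<open>\<open>walk \<xi> x\<close> is the height of the column of unit squares to the left of the vertices \<open>(x, y)\<close>, and
  \<open>walk \<eta> y\<close> that of the row below them. The path enters \<open>v\<close> by a vertical edge lying in the row
  \<open>face \<xi> v\<close>, and \<open>level \<xi> \<eta> v\<close> is the smaller of the heights on its two sides.\<close>

definition face :: "(int \<Rightarrow> int) \<Rightarrow> vertex \<Rightarrow> int" where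
  "face \<xi> = (\<lambda>(x, y). if \<xi> x = 1 then y else y + 1)"

definition bond :: "(int \<Rightarrow> int) \<Rightarrow> int \<Rightarrow> int" where
  "bond \<xi> x = min (walk \<xi> x) (walk \<xi> (x + 1))"

definition level :: "(int \<Rightarrow> int) \<Rightarrow> (int \<Rightarrow> int) \<Rightarrow> vertex \<Rightarrow> int" where
  "level \<xi> \<eta> v = bond \<xi> (fst v) + walk \<eta> (face \<xi> v)"

text \<open>The two squares at an open edge differ in height by one, and the path has the lower one
  on its left. At a turn the square on the inner side is the same before and after, so neither
  height changes.\<close>

lemma level_step:
  assumes "pm \<xi>" "pm \<eta>"
  shows "level \<xi> \<eta> (step \<xi> \<eta> v) = level \<xi> \<eta> v"
proof (cases v)
  case (Pair x y)
  have "\<xi> x = 1 \<or> \<xi> x = -1" "\<eta> y = 1 \<or> \<eta> y = -1" "\<xi> (x - \<eta> y) = 1 \<or> \<xi> (x - \<eta> y) = -1"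
    using assms by (auto simp: pm_def)
  then show ?thesis
    using walk_Suc[of \<eta> y] walk_Suc[of \<xi> x] walk_Suc[of \<xi> "x + 1"] walk_pred[of \<xi> x]
    by (elim disjE) (simp_all add: Pair level_def step_def face_def bond_def)
qed

lemma face_step:
  assumes "pm \<xi>" "pm \<eta>"
  shows "\<bar>face \<xi> (step \<xi> \<eta> v) - face \<xi> v\<bar> \<le> 1"
proof (cases v)
  case (Pair x y)
  have "\<xi> x = 1 \<or> \<xi> x = -1" "\<xi> (x - \<eta> y) = 1 \<or> \<xi> (x - \<eta> y) = -1"
    using assms by (auto simp: pm_def)
  then show ?thesis by (elim disjE) (simp_all add: Pair step_def face_def)
qed

lemma level_orbit:
  assumes "pm \<xi>" "pm \<eta>"
  shows "level \<xi> \<eta> ((step \<xi> \<eta> ^^ n) v) = level \<xi> \<eta> v"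
  by (induction n) (simp_all add: level_step assms)

text \<open>The mixture of weak and strict inequality says that the walk crosses from height
  \<open>walk \<xi> x\<close> to the next one exactly once, namely in the step after
  \<open>x\<close>.\<close>

definition cut :: "(int \<Rightarrow> int) \<Rightarrow> int \<Rightarrow> bool" where
  "cut \<xi> x \<longleftrightarrow> (\<forall>z\<le>x. walk \<xi> z \<le> walk \<xi> x) \<and> (\<forall>z>x. walk \<xi> x < walk \<xi> z)"

lemma cut_shift: "cut (shift t \<xi>) x \<longleftrightarrow> cut \<xi> (x + t)"
proof -
  have "(\<forall>z\<le>x. walk \<xi> (z + t) \<le> walk \<xi> (x + t)) \<longleftrightarrow> (\<forall>z\<le>x + t. walk \<xi> z \<le> walk \<xi> (x + t))"
    by (metis add_le_cancel_right diff_add_cancel)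
  moreover have "(\<forall>z>x. walk \<xi> (x + t) < walk \<xi> (z + t)) \<longleftrightarrow> (\<forall>z>x + t. walk \<xi> (x + t) < walk \<xi> z)"
    by (metis add_less_cancel_right diff_add_cancel)
  ultimately show ?thesis by (simp add: cut_def walk_shift)
qed

lemma cut_sign:
  assumes "pm \<xi>" "cut \<xi> x"
  shows "\<xi> x = 1"
proof -
  have "walk \<xi> x < walk \<xi> (x + 1)" using assms(2) by (simp add: cut_def)
  then have "\<xi> x > 0" by (simp add: walk_Suc)
  with assms(1) show ?thesis unfolding pm_def by (metis neg_0_less_iff_less not_one_less_zero)
qed

lemma bond_cut:
  assumes "pm \<xi>" "cut \<xi> x"
  shows "bond \<xi> z = walk \<xi> x \<longleftrightarrow> z = x"
proof -
  consider "z < x" | "z = x" | "z > x" by linarith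
  then show ?thesis
  proof cases
    case 1
    then have "walk \<xi> z \<le> walk \<xi> x" "walk \<xi> (z + 1) \<le> walk \<xi> x"
      using assms(2) by (auto simp: cut_def)
    moreover have "walk \<xi> z \<noteq> walk \<xi> (z + 1)"
      using assms(1) by (metis add_cancel_left_right neg_equal_0_iff_equal pm_def walk_Suc zero_neq_one)
    ultimately show ?thesis using 1 by (auto simp: bond_def)
  next
    case 2
    moreover have "walk \<xi> x < walk \<xi> (x + 1)" using assms(2) by (simp add: cut_def)
    ultimately show ?thesis by (simp add: bond_def)
  next
    case 3
    then have "walk \<xi> x < walk \<xi> z" "walk \<xi> x < walk \<xi> (z + 1)"
      using assms(2) by (auto simp: cut_def)
    with 3 show ?thesis by (auto simp: bond_def)
  qed
qed

lemma level_cut: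
  assumes "pm \<xi>" "cut \<xi> x"
  shows "level \<xi> \<eta> (x, y) = walk \<xi> x + walk \<eta> y" "face \<xi> (x, y) = y"
  using cut_sign[OF assms] bond_cut[OF assms] by (simp_all add: level_def face_def)

text \<open>The level forces \<open>bond \<xi> (fst v) = walk \<xi> x\<close>, hence the column
  \<open>x\<close>. In this form cuts act as gates: a path of this level can be in row
  \<open>c\<close> only at \<open>(x, c)\<close>.\<close>

lemma level_face_cut:
  assumes "pm \<xi>" "cut \<xi> x" "level \<xi> \<eta> v = walk \<xi> x + walk \<eta> c" "face \<xi> v = c"
  shows "v = (x, c)"
proof (cases v)
  case (Pair a b)
  with assms have "a = x" using bond_cut[OF assms(1,2), of a] by (simp add: level_def)
  with assms Pair show ?thesis using cut_sign[OF assms(1,2)] by (simp add: face_def)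
qed

text \<open>Successive vertical edges of the path lie in different columns, while row
  \<open>y\<close> contains only one edge of this level. So the path changes row on both sides of
  \<open>(x, y)\<close>, and \<open>\<xi> x = 1\<close> makes the passage upward.\<close>

lemma face_step_cut:
  assumes "pm \<xi>" "pm \<eta>" "cut \<xi> x"
  shows "face \<xi> (step \<xi> \<eta> (x, y)) = y + 1" "face \<xi> (unstep \<xi> \<eta> (x, y)) = y - 1"
proof -
  have sg: "\<xi> x = 1" "\<eta> y \<noteq> 0" "\<eta> (y - 1) \<noteq> 0"
    using cut_sign assms by (auto simp: pm_def) (metis neg_equal_0_iff_equal zero_neq_one)+
  have "level \<xi> \<eta> (step \<xi> \<eta> (x, y)) = walk \<xi> x + walk \<eta> y"
    using level_step level_cut assms by simp
  then have "face \<xi> (step \<xi> \<eta> (x, y)) \<noteq> y"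
    using level_face_cut[of \<xi> x \<eta> "step \<xi> \<eta> (x, y)" y] assms sg by (auto simp: step_def)
  moreover have "\<xi> (x - \<eta> y) = 1 \<or> \<xi> (x - \<eta> y) = -1" using assms by (auto simp: pm_def)
  ultimately show "face \<xi> (step \<xi> \<eta> (x, y)) = y + 1" by (auto simp: step_def face_def)
  have "level \<xi> \<eta> (unstep \<xi> \<eta> (x, y)) = walk \<xi> x + walk \<eta> y"
    using level_step[of \<xi> \<eta> "unstep \<xi> \<eta> (x, y)"] level_cut assms by simp
  then have "face \<xi> (unstep \<xi> \<eta> (x, y)) \<noteq> y"
    using level_face_cut[of \<xi> x \<eta> "unstep \<xi> \<eta> (x, y)" y] assms sg by (auto simp: unstep_def)
  then show "face \<xi> (unstep \<xi> \<eta> (x, y)) = y - 1"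
    using sg by (auto simp: unstep_def face_def split: if_splits)
qed

section \<open>Level lines trapped between two cuts\<close>

definition drifting :: "(int \<Rightarrow> int) \<Rightarrow> bool" where
  "drifting \<xi> \<longleftrightarrow> pm \<xi> \<and> filterlim (walk \<xi>) at_top at_top \<and> filterlim (walk \<xi>) at_bot at_bot"

lemma drifting_finite:
  assumes "drifting \<xi>"
  shows "finite {x. bond \<xi> x = c}"
proof -
  have "eventually (\<lambda>x. c + 1 \<le> walk \<xi> x) at_top"
    using assms unfolding drifting_def filterlim_at_top by blast
  moreover have "eventually (\<lambda>x. walk \<xi> x \<le> c - 1) at_bot"
    using assms unfolding drifting_def filterlim_at_bot by blast
  ultimately obtain a b where b: "\<And>x. x \<ge> b \<Longrightarrow> c + 1 \<le> walk \<xi> x" and a: "\<And>x. x \<le> a \<Longrightarrow> walk \<xi> x \<le> c - 1"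
    by (auto simp: eventually_at_top_linorder eventually_at_bot_linorder)
  have "{x. bond \<xi> x = c} \<subseteq> {a..b}"
  proof
    fix x assume "x \<in> {x. bond \<xi> x = c}"
    then have "min (walk \<xi> x) (walk \<xi> (x + 1)) = c" by (simp add: bond_def)
    then show "x \<in> {a..b}" using a[of x] b[of x] b[of "x + 1"] by (cases "x < a"; cases "x > b") auto
  qed
  then show ?thesis using finite_subset by blast
qed

lemma finite_strip:
  assumes "drifting \<xi>"
  shows "finite {v. level \<xi> \<eta> v = l \<and> face \<xi> v \<in> {c..d}}"
proof (rule finite_subset)
  show "{v. level \<xi> \<eta> v = l \<and> face \<xi> v \<in> {c..d}}
      \<subseteq> (\<Union>j\<in>{c..d}. {x. bond \<xi> x = l - walk \<eta> j}) \<times> {c - 1..d}"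
    by (auto simp: level_def face_def split: if_splits)
  show "finite ((\<Union>j\<in>{c..d}. {x. bond \<xi> x = l - walk \<eta> j}) \<times> {c - 1..d})"
    using drifting_finite[OF assms] by auto
qed

text \<open>Pigeonhole gives two equal iterates; injectivity cancels their common initial part, so
  the cycle contains \<open>v\<close> itself.\<close>

lemma inj_finite_orbit_periodic:
  assumes "inj f" "finite Z" "\<And>n. (f ^^ n) v \<in> Z"
  shows "\<exists>n>0. (f ^^ n) v = v"
proof -
  have "\<not> inj (\<lambda>n. (f ^^ n) v)"
    using assms(2,3) finite_subset[of "range (\<lambda>n. (f ^^ n) v)" Z] finite_imageD infinite_UNIV_nat by blast
  then obtain m n where mn: "m < n" "(f ^^ m) v = (f ^^ n) v"
    unfolding inj_def by (metis linorder_neqE_nat)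
  have "(f ^^ n) v = (f ^^ m) ((f ^^ (n - m)) v)"
    using mn(1) by (metis comp_apply funpow_add le_add_diff_inverse less_imp_le_nat)
  then have "(f ^^ (n - m)) v = v"
    using mn(2) inj_fn[OF assms(1), of m] by (metis injD)
  with mn(1) show ?thesis by (metis zero_less_diff)
qed

text \<open>The row of the path changes by at most one per step, and the rows \<open>c\<close> and
  \<open>d\<close> can be entered only at the two gates. A path that avoids both gates stays in a
  strip with finitely many vertices of its level, so it is periodic.\<close>

lemma trapped:
  assumes dr: "drifting \<xi>" and pe: "pm \<eta>" and cuts: "cut \<xi> a" "cut \<xi> b"
    and la: "walk \<xi> a + walk \<eta> c = level \<xi> \<eta> v" and lb: "walk \<xi> b + walk \<eta> d = level \<xi> \<eta> v"
    and fv: "c < face \<xi> v" "face \<xi> v < d"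
  shows "(\<exists>n. (step \<xi> \<eta> ^^ n) v \<in> {(a, c), (b, d)}) \<or> (\<exists>n>0. (step \<xi> \<eta> ^^ n) v = v)"
proof (rule disjCI)
  let ?f = "step \<xi> \<eta>"
  assume *: "\<not> (\<exists>n>0. (?f ^^ n) v = v)"
  have px: "pm \<xi>" using dr by (simp add: drifting_def)
  show "\<exists>n. (?f ^^ n) v \<in> {(a, c), (b, d)}"
  proof (rule ccontr)
    assume no: "\<nexists>n. (?f ^^ n) v \<in> {(a, c), (b, d)}"
    have lev: "level \<xi> \<eta> ((?f ^^ n) v) = level \<xi> \<eta> v" for n
      by (rule level_orbit[OF px pe])
    have "c < face \<xi> ((?f ^^ n) v) \<and> face \<xi> ((?f ^^ n) v) < d" for n
    proof (induction n)
      case 0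
      with fv show ?case by simp
    next
      case (Suc n)
      have "(?f ^^ Suc n) v \<noteq> (a, c)" "(?f ^^ Suc n) v \<noteq> (b, d)" using no by blast+
      then have "face \<xi> ((?f ^^ Suc n) v) \<noteq> c" "face \<xi> ((?f ^^ Suc n) v) \<noteq> d"
        using level_face_cut[OF px cuts(1), of \<eta> "(?f ^^ Suc n) v" c]
          level_face_cut[OF px cuts(2), of \<eta> "(?f ^^ Suc n) v" d] lev[of "Suc n"] la lb by metis+
      then show ?case using Suc face_step[OF px pe, of "(?f ^^ n) v"] by auto
    qed
    then have "(?f ^^ n) v \<in> {v'. level \<xi> \<eta> v' = level \<xi> \<eta> v \<and> face \<xi> v' \<in> {c..d}}" for n
      using lev by (simp add: less_imp_le)
    from inj_finite_orbit_periodic[OF inj_step finite_strip[OF dr] this] * show False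
      by blast
  qed
qed

text \<open>The path leaves \<open>(a, c)\<close> upwards. If it missed \<open>(b, d)\<close>, it
  would be trapped and return to \<open>(a, c)\<close>; but a return comes from row
  \<open>c - 1\<close>, which cannot be reached from above without an earlier passage through
  \<open>(a, c)\<close>.\<close>

lemma cuts_connected:
  assumes dr: "drifting \<xi>" and pe: "pm \<eta>" and cuts: "cut \<xi> a" "cut \<xi> b"
    and eq: "walk \<xi> a + walk \<eta> c = walk \<xi> b + walk \<eta> d" and less: "c < d"
  shows "\<exists>n. (step \<xi> \<eta> ^^ n) (a, c) = (b, d)"
proof (rule ccontr)
  let ?f = "step \<xi> \<eta>"
  assume no: "\<nexists>n. (?f ^^ n) (a, c) = (b, d)"
  have px: "pm \<xi>" using dr by (simp add: drifting_def)
  define w where "w = ?f (a, c)"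
  have pw: "(?f ^^ n) w = (?f ^^ Suc n) (a, c)" for n
    by (simp add: w_def funpow_swap1)
  have fw: "face \<xi> w = c + 1" using face_step_cut[OF px pe cuts(1)] by (simp add: w_def)
  have lw: "level \<xi> \<eta> w = walk \<xi> a + walk \<eta> c"
    using level_step[OF px pe] level_cut[OF px cuts(1)] by (simp add: w_def)
  \<comment> \<open>For \<open>d = c + 1\<close> the first step already reaches row
    \<open>d\<close>, where the only vertex of this level is \<open>(b, d)\<close>; this must be
    excluded before \<open>trapped\<close> applies.\<close>
  have "(?f ^^ Suc 0) (a, c) \<noteq> (b, d)" using no by blast
  then have "w \<noteq> (b, d)" by (simp add: w_def)
  then have "face \<xi> w \<noteq> d"
    using level_face_cut[OF px cuts(2), of \<eta> w d] lw eq by auto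
  with fw less have "face \<xi> w < d" by simp
  have "walk \<xi> b + walk \<eta> d = level \<xi> \<eta> w" using lw eq by metis
  moreover have "c < face \<xi> w" using fw by linarith
  ultimately have "(\<exists>n. (?f ^^ n) w \<in> {(a, c), (b, d)}) \<or> (\<exists>n>0. (?f ^^ n) w = w)"
    using \<open>face \<xi> w < d\<close> by (rule trapped[OF dr pe cuts lw[symmetric]])
  then have "\<exists>n>0. (?f ^^ n) (a, c) = (a, c)"
  proof
    assume "\<exists>n. (?f ^^ n) w \<in> {(a, c), (b, d)}"
    then obtain n where "(?f ^^ Suc n) (a, c) \<in> {(a, c), (b, d)}" unfolding pw by blast
    with no have "(?f ^^ Suc n) (a, c) = (a, c)" by blast
    then show ?thesis by (metis zero_less_Suc)
  next
    assume "\<exists>n>0. (?f ^^ n) w = w"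
    then obtain n where n: "n > 0" "(?f ^^ n) w = w" by blast
    then have "?f ((?f ^^ n) (a, c)) = ?f (a, c)" using pw[of n] by (simp add: w_def)
    then have "(?f ^^ n) (a, c) = (a, c)" using inj_step injD by metis
    with n show ?thesis by blast
  qed
  then have ex: "\<exists>n. n > 0 \<and> (?f ^^ n) (a, c) = (a, c)" by blast
  \<comment> \<open>With the least period, the path does not meet \<open>(a, c)\<close> before time
    \<open>k\<close>, so it is strictly between the rows \<open>c\<close> and \<open>d\<close> at
    the times \<open>1\<close> to \<open>k - 1\<close>.\<close>
  define k where "k = (LEAST n. n > 0 \<and> (?f ^^ n) (a, c) = (a, c))"
  have k: "k > 0" "(?f ^^ k) (a, c) = (a, c)" using LeastI_ex[OF ex] by (auto simp: k_def)
  have kmin: "(?f ^^ n) (a, c) \<noteq> (a, c)" if "0 < n" "n < k" for n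
    using not_less_Least[of n] that by (auto simp: k_def)
  obtain m where m: "k = Suc m" using k(1) by (cases k) auto
  have inside: "c < face \<xi> ((?f ^^ n) w) \<and> face \<xi> ((?f ^^ n) w) < d" if "n < m" for n
    using that
  proof (induction n)
    case 0
    with fw \<open>face \<xi> w < d\<close> show ?case by simp
  next
    case (Suc n)
    have lev: "level \<xi> \<eta> ((?f ^^ Suc n) w) = walk \<xi> a + walk \<eta> c"
      using level_orbit[OF px pe] lw by metis
    have "(?f ^^ Suc n) w \<noteq> (a, c)" using kmin[of "Suc (Suc n)"] pw[of "Suc n"] Suc.prems m by simp
    moreover have "(?f ^^ Suc n) w \<noteq> (b, d)" using no pw[of "Suc n"] by metis
    ultimately have "face \<xi> ((?f ^^ Suc n) w) \<noteq> c" "face \<xi> ((?f ^^ Suc n) w) \<noteq> d"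
      using level_face_cut[OF px cuts(1), of \<eta> "(?f ^^ Suc n) w" c]
          level_face_cut[OF px cuts(2), of \<eta> "(?f ^^ Suc n) w" d] lev eq by metis+
    then show ?case using Suc face_step[OF px pe, of "(?f ^^ n) w"] by auto
  qed
  have "?f ((?f ^^ m) (a, c)) = (a, c)" using k(2) m by simp
  then have "(?f ^^ m) (a, c) = unstep \<xi> \<eta> (a, c)" by (metis unstep_step)
  then have fm: "face \<xi> ((?f ^^ m) (a, c)) = c - 1"
    using face_step_cut[OF px pe cuts(1)] by simp
  show False
  proof (cases m)
    case 0
    then show False using fm level_cut[OF px cuts(1)] by simp
  next
    case (Suc n)
    then show False using fm inside[of n] pw[of n] by simp
  qed
qed

section \<open>Cut vertices of a given level in far rows\<close>

lemma walk_intermediate: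
  assumes "pm f" "a \<le> b" "walk f a \<le> c \<and> c \<le> walk f b \<or> walk f b \<le> c \<and> c \<le> walk f a"
  shows "\<exists>y\<in>{a..b}. walk f y = c"
proof -
  have ivt: "\<exists>y\<in>{a..b}. g y = k"
    if "\<And>x. \<bar>g (x + 1) - g x\<bar> \<le> 1" "g a \<le> k" "k \<le> g b" for g :: "int \<Rightarrow> int" and k
  proof -
    have "\<exists>i\<le>nat (b - a). g (a + int i) = k"
    proof (rule nat0_intermed_int_val)
      show "\<forall>i<nat (b - a). \<bar>g (a + int (i + 1)) - g (a + int i)\<bar> \<le> 1"
        using that(1)[of "a + int _"] by (simp add: add.assoc add.commute add.left_commute)
    qed (use that assms(2) in auto)
    then obtain i where "i \<le> nat (b - a)" "g (a + int i) = k" by blast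
    then show ?thesis using assms(2) by (intro bexI[of _ "a + int i"]) auto
  qed
  from assms(3) show ?thesis
  proof
    assume "walk f a \<le> c \<and> c \<le> walk f b"
    then show ?thesis using ivt[of "walk f" c] walk_step_abs[OF assms(1)] by blast
  next
    assume *: "walk f b \<le> c \<and> c \<le> walk f a"
    have "\<bar>- walk f (x + 1) - - walk f x\<bar> \<le> 1" for x
      using walk_step_abs[OF assms(1), of x] by simp
    then show ?thesis using ivt[of "\<lambda>x. - walk f x" "- c"] * by auto
  qed
qed

definition cofinal_cuts :: "(int \<Rightarrow> int) \<Rightarrow> bool" where
  "cofinal_cuts \<xi> \<longleftrightarrow> (\<forall>m. (\<exists>x. cut \<xi> x \<and> m < walk \<xi> x) \<and> (\<exists>x. cut \<xi> x \<and> walk \<xi> x < m))"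

text \<open>The modulus is used because the walk of \<open>\<eta>\<close> may drift either way or
  oscillate, according to \<open>q\<close>.\<close>

definition unbounded_walk :: "(int \<Rightarrow> int) \<Rightarrow> bool" where
  "unbounded_walk \<eta> \<longleftrightarrow>
     (\<forall>j m. (\<exists>y>j. m < \<bar>walk \<eta> y\<bar>) \<and> (\<exists>y<j. m < \<bar>walk \<eta> y\<bar>))"

definition typical :: "(int \<Rightarrow> int) \<Rightarrow> (int \<Rightarrow> int) \<Rightarrow> bool" where
  "typical \<xi> \<eta> \<longleftrightarrow> drifting \<xi> \<and> cofinal_cuts \<xi> \<and> pm \<eta> \<and> unbounded_walk \<eta>"

text \<open>The cuts \<open>x1\<close> and \<open>x2\<close> ask for row heights below and above
  \<open>walk \<eta> j\<close>. A row where \<open>walk \<eta> y\<close> has large modulus lies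
  beyond one of these heights, whatever its sign, so the walk meets that height between
  \<open>j\<close> and \<open>y\<close>.\<close>

lemma cut_walk_between:
  assumes "typical \<xi> \<eta>" "\<And>m. \<exists>y\<in>Y. m < \<bar>walk \<eta> y\<bar>" "j \<in> Y" "\<And>a b. a \<in> Y \<Longrightarrow> b \<in> Y \<Longrightarrow> {a..b} \<subseteq> Y"
  shows "\<exists>x. \<exists>y\<in>Y. cut \<xi> x \<and> walk \<xi> x + walk \<eta> y = l"
proof -
  have pe: "pm \<eta>" using assms by (simp add: typical_def)
  obtain x1 x2 where x: "cut \<xi> x1" "cut \<xi> x2" "l - walk \<eta> j < walk \<xi> x1" "walk \<xi> x2 < l - walk \<eta> j"
    using assms(1) unfolding typical_def cofinal_cuts_def by meson
  obtain y where y: "y \<in> Y" "\<bar>l - walk \<xi> x1\<bar> + \<bar>l - walk \<xi> x2\<bar> < \<bar>walk \<eta> y\<bar>"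
    using assms(2) by blast
  have "\<exists>x\<in>{x1, x2}. \<exists>z\<in>{min j y..max j y}. walk \<eta> z = l - walk \<xi> x"
  proof (cases "walk \<eta> y > 0")
    case True
    with x y show ?thesis
      using walk_intermediate[OF pe, of "min j y" "max j y" "l - walk \<xi> x2"] by (auto simp: min_def max_def)
  next
    case False
    with x y show ?thesis
      using walk_intermediate[OF pe, of "min j y" "max j y" "l - walk \<xi> x1"] by (auto simp: min_def max_def)
  qed
  then obtain u z where uz: "u \<in> {x1, x2}" "z \<in> {min j y..max j y}" "walk \<eta> z = l - walk \<xi> u"
    by blast
  have "z \<in> Y" using assms(4)[of "min j y" "max j y"] assms(3) y(1) uz(2) by (auto simp: min_def max_def split: if_splits)
  moreover have "cut \<xi> u" using uz(1) x by blast
  ultimately show ?thesis using uz(3) by force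
qed

lemma cut_row_above:
  assumes "typical \<xi> \<eta>"
  shows "\<exists>x y. j < y \<and> cut \<xi> x \<and> walk \<xi> x + walk \<eta> y = l"
  using cut_walk_between[OF assms, of "{j + 1..}" "j + 1" l] assms
  unfolding typical_def unbounded_walk_def by (force simp: zless_imp_add1_zle)

lemma cut_row_below:
  assumes "typical \<xi> \<eta>"
  shows "\<exists>x y. y < j \<and> cut \<xi> x \<and> walk \<xi> x + walk \<eta> y = l"
  using cut_walk_between[OF assms, of "{..j - 1}" "j - 1" l] assms
  unfolding typical_def unbounded_walk_def by force

lemma orbit_hits_cut:
  assumes ty: "typical \<xi> \<eta>" and np: "\<And>n. n > 0 \<Longrightarrow> (step \<xi> \<eta> ^^ n) v \<noteq> v"
  shows "\<exists>n x y. (step \<xi> \<eta> ^^ n) v = (x, y) \<and> cut \<xi> x"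
proof -
  obtain a c where ac: "c < face \<xi> v" "cut \<xi> a" "walk \<xi> a + walk \<eta> c = level \<xi> \<eta> v"
    using cut_row_below[OF ty] by blast
  obtain b d where bd: "face \<xi> v < d" "cut \<xi> b" "walk \<xi> b + walk \<eta> d = level \<xi> \<eta> v"
    using cut_row_above[OF ty] by blast
  have "drifting \<xi>" "pm \<eta>" using ty by (auto simp: typical_def)
  from trapped[OF this ac(2) bd(2) ac(3) bd(3) ac(1) bd(1)] np
  show ?thesis using ac bd by blast
qed

section \<open>Invariance under recentring along the path\<close>

definition path_invariant :: "((int \<Rightarrow> int) \<times> (int \<Rightarrow> int) \<Rightarrow> bool) \<Rightarrow> bool" where
  "path_invariant \<Phi> \<longleftrightarrow> (\<forall>\<xi> \<eta> a b. pm \<xi> \<longrightarrow> pm \<eta> \<longrightarrow> step \<xi> \<eta> (0, 0) = (a, b) \<longrightarrow>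
     \<Phi> (shift a \<xi>, shift b \<eta>) = \<Phi> (\<xi>, \<eta>))"

lemma path_invariant_step:
  assumes "path_invariant \<Phi>" "pm \<xi>" "pm \<eta>" "step \<xi> \<eta> (a, b) = (c, d)"
  shows "\<Phi> (shift c \<xi>, shift d \<eta>) = \<Phi> (shift a \<xi>, shift b \<eta>)"
proof -
  have "step (shift a \<xi>) (shift b \<eta>) (0, 0) + (a, b) = (c, d)"
    using assms(4) step_shift[of a \<xi> b \<eta> "(0, 0)"] by simp
  then have "step (shift a \<xi>) (shift b \<eta>) (0, 0) = (c - a, d - b)"
    by (metis add_diff_cancel_right' diff_Pair)
  then have "\<Phi> (shift (c - a) (shift a \<xi>), shift (d - b) (shift b \<eta>)) = \<Phi> (shift a \<xi>, shift b \<eta>)"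
    using assms(1-3) unfolding path_invariant_def by (meson pm_shift)
  then show ?thesis by simp
qed

lemma path_invariant_orbit:
  assumes "path_invariant \<Phi>" "pm \<xi>" "pm \<eta>" "(step \<xi> \<eta> ^^ n) (a, b) = (c, d)"
  shows "\<Phi> (shift c \<xi>, shift d \<eta>) = \<Phi> (shift a \<xi>, shift b \<eta>)"
  using assms(4)
proof (induction n arbitrary: c d)
  case (Suc n)
  obtain e f where ef: "(step \<xi> \<eta> ^^ n) (a, b) = (e, f)" by fastforce
  with Suc.prems have "step \<xi> \<eta> (e, f) = (c, d)" by simp
  with Suc.IH[OF ef] path_invariant_step[OF assms(1-3)] show ?case by metis
qed simp

lemma path_invariant_cuts:
  assumes "path_invariant \<Phi>" "drifting \<xi>" "pm \<eta>" "cut \<xi> a" "cut \<xi> b"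
    and "walk \<xi> a + walk \<eta> c = walk \<xi> b + walk \<eta> d" "c < d"
  shows "\<Phi> (shift b \<xi>, shift d \<eta>) = \<Phi> (shift a \<xi>, shift c \<eta>)"
  using cuts_connected[OF assms(2-7)] path_invariant_orbit[OF assms(1) _ assms(3)] assms(2)
  unfolding drifting_def by blast

section \<open>Independent signs and mixing\<close>

text \<open>\<open>F\<close> will be an increasing sequence of algebras of local events; one notion
  serves both single sign sequences and pairs of them.\<close>

definition approximable :: "'a measure \<Rightarrow> (nat \<Rightarrow> 'a set set) \<Rightarrow> 'a set \<Rightarrow> bool" where
  "approximable M F E \<longleftrightarrow> (\<forall>\<epsilon>>0. \<exists>k. \<exists>G\<in>F k. measure M (sym_diff E G) < \<epsilon>)"

lemma approximableI:
  assumes "E \<in> F k"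
  shows "approximable M F E"
  using assms unfolding approximable_def by (metis Diff_cancel Un_absorb measure_empty)

text \<open>Approximability passes to complements and countable unions: a union is first truncated,
  then its finitely many members are approximated within a common \<open>F K\<close>.\<close>

lemma (in finite_measure) approximable_sigma_sets:
  assumes F: "\<And>k. F k \<subseteq> sets M" "\<And>k A. A \<in> F k \<Longrightarrow> space M - A \<in> F k"
      "\<And>k A B. A \<in> F k \<Longrightarrow> B \<in> F k \<Longrightarrow> A \<union> B \<in> F k" "\<And>k. {} \<in> F k" "mono F"
    and gen: "sets M = sigma_sets (space M) \<G>" "\<And>g. g \<in> \<G> \<Longrightarrow> approximable M F g"
    and E: "E \<in> sets M"
  shows "approximable M F E"
proof -
  from E have "E \<in> sigma_sets (space M) \<G>" using gen(1) by simp
  then show ?thesis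
  proof induction
    case (Basic a)
    then show ?case by (rule gen(2))
  next
    case Empty
    show ?case by (rule approximableI[where k = 0]) (rule F(4))
  next
    case (Compl a)
    have a: "a \<subseteq> space M" using Compl.hyps gen(1) sets.sets_into_space by blast
    show ?case unfolding approximable_def
    proof (intro allI impI)
      fix \<epsilon> :: real assume "\<epsilon> > 0"
      then obtain k G where G: "G \<in> F k" "measure M (sym_diff a G) < \<epsilon>"
        using Compl.IH unfolding approximable_def by blast
      moreover have "sym_diff (space M - a) (space M - G) = sym_diff a G"
        using a F(1)[of k] G(1) sets.sets_into_space by blast
      ultimately show "\<exists>k. \<exists>G\<in>F k. measure M (sym_diff (space M - a) G) < \<epsilon>"
        using F(2) by metis
    qed
  next
    case (Union a)
    have a: "\<And>i. a i \<in> sets M" using Union.hyps gen(1) by blast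
    show ?case unfolding approximable_def
    proof (intro allI impI)
      fix \<epsilon> :: real assume e: "\<epsilon> > 0"
      define A where "A n = (\<Union>i<n. a i)" for n
      have A: "\<And>n. A n \<in> sets M" using a by (auto simp: A_def)
      have "(\<lambda>n. measure M (A n)) \<longlonglongrightarrow> measure M (\<Union>n. A n)"
        using A by (intro finite_Lim_measure_incseq) (auto simp: incseq_def A_def intro: less_le_trans)
      moreover have UA: "(\<Union>n. A n) = (\<Union>i. a i)" by (auto simp: A_def)
      ultimately have "eventually (\<lambda>n. \<bar>measure M (A n) - measure M (\<Union>i. a i)\<bar> < \<epsilon> / 2) sequentially"
        using e unfolding UA tendsto_iff dist_real_def by (meson half_gt_zero)
      then obtain n where n: "\<bar>measure M (A n) - measure M (\<Union>i. a i)\<bar> < \<epsilon> / 2"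
        using eventually_happens trivial_limit_sequentially by blast
      have U: "(\<Union>i. a i) \<in> sets M" using a by blast
      have "measure M ((\<Union>i. a i) - A n) = measure M (\<Union>i. a i) - measure M (A n)"
        using A U by (intro finite_measure_Diff) (auto simp: A_def)
      with n have d1: "measure M ((\<Union>i. a i) - A n) < \<epsilon> / 2" by linarith
      \<comment> \<open>The \<open>+ 1\<close> covers \<open>n = 0\<close>; \<open>n\<close> errors
        of this size add up to at most \<open>\<epsilon> / 2\<close>.\<close>
      define \<delta> where "\<delta> = \<epsilon> / (2 * (real n + 1))"
      have d: "\<delta> > 0" using e by (simp add: \<delta>_def)
      have "\<forall>i. \<exists>k G. G \<in> F k \<and> measure M (sym_diff (a i) G) < \<delta>"
        using Union.IH d unfolding approximable_def by blast
      then obtain k G where G: "\<And>i. G i \<in> F (k i)" "\<And>i. measure M (sym_diff (a i) (G i)) < \<delta>"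
        by metis
      define K where "K = Max (k ` {..n})"
      have "G i \<in> F K" if "i < n" for i
        using G(1)[of i] monoD[OF F(5), of "k i" K] that by (auto simp: K_def)
      then have un: "(\<Union>i<m. G i) \<in> F K" if "m \<le> n" for m
        using that by (induction m) (auto simp: lessThan_Suc F(3,4))
      have Gs: "\<And>i. G i \<in> sets M" using F(1) G(1) by blast
      have AnU: "A n \<subseteq> (\<Union>i. a i)" by (auto simp: A_def)
      have sd: "sym_diff (a i) (G i) \<in> sets M" for i using a Gs by auto
      have sd': "(\<Union>i<n. sym_diff (a i) (G i)) \<in> sets M" using sd by blast
      have "measure M (sym_diff (\<Union>i. a i) (\<Union>i<n. G i))
          \<le> measure M (((\<Union>i. a i) - A n) \<union> (\<Union>i<n. sym_diff (a i) (G i)))"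
        using A U sd' by (intro finite_measure_mono) (auto simp: A_def)
      also have "\<dots> \<le> measure M ((\<Union>i. a i) - A n) + measure M (\<Union>i<n. sym_diff (a i) (G i))"
        using A U sd' by (intro measure_Un_le) auto
      also have "measure M (\<Union>i<n. sym_diff (a i) (G i)) \<le> (\<Sum>i<n. measure M (sym_diff (a i) (G i)))"
        using sd by (intro finite_measure_subadditive_finite) auto
      also have "\<dots> \<le> (\<Sum>i<n. \<delta>)" by (intro sum_mono less_imp_le G(2))
      also have "\<dots> \<le> \<epsilon> / 2"
        using e by (simp add: \<delta>_def field_simps)
      finally have "measure M (sym_diff (\<Union>i. a i) (\<Union>i<n. G i)) < \<epsilon>" using d1 by simp
      then show "\<exists>k. \<exists>G\<in>F k. measure M (sym_diff (\<Union> (range a)) G) < \<epsilon>"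
        using un[of n] by blast
    qed
  qed
qed

section \<open>The product measure of signs\<close>

definition coin :: "real \<Rightarrow> int measure" where
  "coin r = measure_pmf (map_pmf (\<lambda>b. if b then 1 else - 1) (bernoulli_pmf r))"

definition coins :: "real \<Rightarrow> (int \<Rightarrow> int) measure" where
  "coins r = (\<Pi>\<^sub>M k\<in>UNIV. coin r)"

lemma prob_space_coin [simp]: "prob_space (coin r)"
  by (simp add: coin_def measure_pmf.prob_space_axioms)

lemma space_coin [simp]: "space (coin r) = UNIV" and sets_coin [simp]: "sets (coin r) = UNIV"
  by (simp_all add: coin_def)

lemma AE_coin: "AE k in coin r. k = 1 \<or> k = - 1"
  unfolding coin_def by (auto simp: AE_measure_pmf_iff split: if_splits)

lemma measure_coin_1: "0 \<le> r \<Longrightarrow> r \<le> 1 \<Longrightarrow> measure (coin r) {1} = r"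
  and measure_coin_m1: "0 \<le> r \<Longrightarrow> r \<le> 1 \<Longrightarrow> measure (coin r) {- 1} = 1 - r"
proof -
  assume r: "0 \<le> r" "r \<le> 1"
  have eq: "(\<lambda>b. if b then 1 else - 1 :: int) -` {1} = {True}" "(\<lambda>b. if b then 1 else - 1 :: int) -` {-1} = {False}"
    by (auto split: if_splits)
  show "measure (coin r) {1} = r" "measure (coin r) {- 1} = 1 - r"
    using r unfolding coin_def measure_map_pmf eq by (simp_all add: measure_pmf_single)
qed

lemma prob_space_coins [simp]: "prob_space (coins r)"
  unfolding coins_def by (rule prob_space_PiM) simp

interpretation coins: prob_space "coins r" for r by simp

lemma space_coins [simp]: "space (coins r) = UNIV"
  by (simp add: coins_def space_PiM)

lemma UNIV_coins [simp]: "UNIV \<in> sets (coins r)"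
  using sets.top[of "coins r"] by simp

lemma sets_coins: "sets (coins r) = sets (\<Pi>\<^sub>M k\<in>UNIV. count_space UNIV)"
  unfolding coins_def by (rule sets_PiM_cong) simp_all

lemma measurable_coord: "(\<lambda>\<xi>. \<xi> k) \<in> coins r \<rightarrow>\<^sub>M count_space UNIV"
proof -
  have "measurable (coins r) (count_space UNIV) = measurable (coins r) (coin r)"
    by (rule measurable_cong_sets) simp_all
  then show ?thesis
    unfolding coins_def using measurable_component_singleton[OF UNIV_I] by metis
qed

lemma measurable_coinsI:
  assumes "\<And>k. (\<lambda>x. f x k) \<in> M \<rightarrow>\<^sub>M count_space UNIV"
  shows "f \<in> M \<rightarrow>\<^sub>M coins r"
proof -
  have "(\<lambda>x. \<lambda>k\<in>UNIV. f x k) \<in> M \<rightarrow>\<^sub>M (\<Pi>\<^sub>M k\<in>UNIV. coin r)"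
    using assms by (intro measurable_restrict) (simp add: measurable_def)
  then show ?thesis by (simp add: coins_def restrict_UNIV)
qed

lemma AE_coins_pm: "AE \<xi> in coins r. pm \<xi>"
proof -
  have "AE \<xi> in coins r. \<xi> k = 1 \<or> \<xi> k = -1" for k
    using AE_PiM_component[of UNIV "\<lambda>_. coin r" k "\<lambda>k. k = 1 \<or> k = -1"] AE_coin
    unfolding coins_def by auto
  then show ?thesis unfolding pm_def by (simp add: AE_all_countable)
qed

lemma measurable_reindex: "(\<lambda>\<xi> k. \<xi> (f k)) \<in> coins r \<rightarrow>\<^sub>M coins s"
  by (intro measurable_coinsI measurable_coord)

text \<open>An injective reindexing selects distinct coordinates, which are again i.i.d.
  Translations, the reversal of the line and the permutations of rows are all instances.\<close>

lemma distr_coins_reindex: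
  assumes "inj f"
  shows "distr (coins r) (coins r) (\<lambda>\<xi> k. \<xi> (f k)) = coins r"
  using distr_PiM_reindex[of UNIV "\<lambda>_. coin r" f UNIV] assms by (simp add: coins_def restrict_UNIV)

lemma measure_coins_reindex:
  assumes "inj f" "E \<in> sets (coins r)"
  shows "measure (coins r) ((\<lambda>\<xi> k. \<xi> (f k)) -` E) = measure (coins r) E"
  using measure_distr[OF measurable_reindex[where f = f and r = r] assms(2)]
  unfolding distr_coins_reindex[OF assms(1)] by simp

lemma sets_coins_reindex:
  assumes "E \<in> sets (coins r)"
  shows "(\<lambda>\<xi> k. \<xi> (f k)) -` E \<in> sets (coins r)"
  using measurable_sets[OF measurable_reindex[where f = f] assms, of r] by simp

lemma AE_coins_reindex:
  assumes "inj f" "AE \<xi> in coins r. P \<xi>"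
  shows "AE \<xi> in coins r. P (\<lambda>k. \<xi> (f k))"
  using assms(2) AE_distrD[OF measurable_reindex[where r = r and s = r and f = f], of P]
  unfolding distr_coins_reindex[OF assms(1)] by simp

lemma indep_coords: "coins.indep_vars r (\<lambda>_. coin r) (\<lambda>k \<xi>. \<xi> k) UNIV"
proof -
  have *: "coins.random_variable r (coin r) (\<lambda>\<xi>. \<xi> i)" for i
    by (simp add: coins_def)
  show ?thesis
    using *
  proof (subst coins.indep_vars_iff_distr_eq_PiM)
    have "distr (coins r) (coin r) (\<lambda>\<xi>. \<xi> i) = coin r" for i
      unfolding coins_def by (rule distr_PiM_component) simp_all
    then show "distr (coins r) (\<Pi>\<^sub>M i\<in>UNIV. coin r) (\<lambda>x. \<lambda>i\<in>UNIV. x i)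
        = (\<Pi>\<^sub>M i\<in>UNIV. distr (coins r) (coin r) (\<lambda>\<xi>. \<xi> i))"
      by (simp add: restrict_UNIV coins_def[symmetric] distr_id2)
  qed simp_all
qed

definition depends_on :: "'i set \<Rightarrow> ('i \<Rightarrow> 'a) set \<Rightarrow> bool" where
  "depends_on A G \<longleftrightarrow> (\<forall>\<xi> \<xi>'. (\<forall>i\<in>A. \<xi> i = \<xi>' i) \<longrightarrow> (\<xi> \<in> G \<longleftrightarrow> \<xi>' \<in> G))"

lemma depends_on_mono: "depends_on A G \<Longrightarrow> A \<subseteq> B \<Longrightarrow> depends_on B G"
  unfolding depends_on_def by (meson subsetD)

text \<open>Filling up with a placeholder \<open>0\<close> turns a partial sequence into a full one.
  Thereby an event that depends on \<open>A\<close> becomes the preimage of a measurable event under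
  restriction to \<open>A\<close>, the form in which independence is available.\<close>

lemma measurable_extend:
  "(\<lambda>u k. if k \<in> A then u k else 0) \<in> (\<Pi>\<^sub>M k\<in>A. coin r) \<rightarrow>\<^sub>M coins r"
proof (rule measurable_coinsI)
  fix k :: int
  have eq: "measurable N (count_space UNIV) = measurable N (coin r)" for N :: "(int \<Rightarrow> int) measure"
    by (rule measurable_cong_sets) simp_all
  show "(\<lambda>u. if k \<in> A then u k else 0) \<in> (\<Pi>\<^sub>M k\<in>A. coin r) \<rightarrow>\<^sub>M count_space UNIV"
  proof (cases "k \<in> A")
    case True
    then show ?thesis unfolding eq if_P[OF True] by (rule measurable_component_singleton)
  next
    case False
    show ?thesis unfolding if_not_P[OF False] by (rule measurable_const) simp
  qed
qed

lemma extend_preimage: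
  assumes "depends_on C K"
  shows "(\<lambda>\<omega>. restrict \<omega> C) -` ((\<lambda>u k. if k \<in> C then u k else 0) -` K
    \<inter> space (\<Pi>\<^sub>M k\<in>C. coin r)) = K"
proof -
  have "(\<lambda>k. if k \<in> C then restrict \<omega> C k else 0) \<in> K \<longleftrightarrow> \<omega> \<in> K" for \<omega>
    by (rule assms[unfolded depends_on_def, rule_format]) simp
  moreover have "restrict \<omega> C \<in> space (\<Pi>\<^sub>M k\<in>C. coin r)" for \<omega>
    by (simp add: space_PiM)
  ultimately show ?thesis by auto
qed

lemma coins_indep:
  assumes "A \<inter> B = {}" "G \<in> sets (coins r)" "H \<in> sets (coins r)" "depends_on A G" "depends_on B H"
  shows "measure (coins r) (G \<inter> H) = measure (coins r) G * measure (coins r) H"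
proof -
  define a where "a = (\<lambda>u k. if k \<in> A then u k else 0) -` G \<inter> space (\<Pi>\<^sub>M k\<in>A. coin r)"
  define b where "b = (\<lambda>u k. if k \<in> B then u k else 0) -` H \<inter> space (\<Pi>\<^sub>M k\<in>B. coin r)"
  have ab: "a \<in> sets (\<Pi>\<^sub>M k\<in>A. coin r)" "b \<in> sets (\<Pi>\<^sub>M k\<in>B. coin r)"
    unfolding a_def b_def by (rule measurable_sets[OF measurable_extend assms(2)],
      rule measurable_sets[OF measurable_extend assms(3)])
  have iv: "coins.indep_var r (PiM A (\<lambda>_. coin r)) (\<lambda>\<omega>. restrict \<omega> A) (PiM B (\<lambda>_. coin r)) (\<lambda>\<omega>. restrict \<omega> B)"
    using coins.indep_var_restrict[OF indep_coords assms(1)] by simp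
  have "(\<lambda>x. (restrict x A, restrict x B)) -` (a \<times> b) = (\<lambda>x. restrict x A) -` a \<inter> (\<lambda>x. restrict x B) -` b"
    by auto
  then show ?thesis
    using coins.indep_varD[OF iv ab] extend_preimage[OF assms(4), of r] extend_preimage[OF assms(5), of r]
    by (simp add: a_def b_def)
qed

section \<open>Local events and mixing\<close>

definition window :: "nat \<Rightarrow> int set" where
  "window k = {- int k..int k}"

lemma window_mono: "k \<le> l \<Longrightarrow> window k \<subseteq> window l"
  by (auto simp: window_def)

definition local_events :: "real \<Rightarrow> nat \<Rightarrow> (int \<Rightarrow> int) set set" where
  "local_events r k = {G \<in> sets (coins r). depends_on (window k) G}"

lemma coins_approximable:
  assumes "E \<in> sets (coins r)"
  shows "approximable (coins r) (local_events r) E"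
proof (rule coins.approximable_sigma_sets[where \<G> = "{{f. f i \<in> A} | i A. True}"])
  show "mono (local_events r)"
    using window_mono depends_on_mono unfolding mono_def local_events_def by blast
  show "sets (coins r) = sigma_sets (space (coins r)) {{f. f i \<in> A} | i A. True}"
    by (simp add: coins_def sets_PiM_single space_PiM)
  show "space (coins r) - A \<in> local_events r k" if "A \<in> local_events r k" for k A
  proof -
    have "space (coins r) - A \<in> sets (coins r)" using that by (intro sets.Diff) (auto simp: local_events_def)
    with that show ?thesis by (simp add: local_events_def depends_on_def)
  qed
  show "A \<union> B \<in> local_events r k" if "A \<in> local_events r k" "B \<in> local_events r k" for k A B
    using that by (auto simp: local_events_def depends_on_def)
  show "approximable (coins r) (local_events r) g" if g: "g \<in> {{f. f i \<in> A} | i A. True}" for g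
  proof -
    obtain i A where g: "g = {f. f i \<in> A}" using g by blast
    have "g \<in> sets (coins r)"
      using measurable_sets[OF measurable_coord[of i r], of A] by (simp add: g vimage_def)
    moreover have "i \<in> window (nat \<bar>i\<bar>)" by (auto simp: window_def)
    then have "depends_on (window (nat \<bar>i\<bar>)) g" unfolding g depends_on_def by auto
    ultimately show ?thesis by (intro approximableI[of _ _ "nat \<bar>i\<bar>"]) (simp add: local_events_def)
  qed
qed (use assms in \<open>auto simp: local_events_def depends_on_def\<close>)

lemma measure_sym_diff_bounds:
  assumes "prob_space M" "E \<in> sets M" "G \<in> sets M"
  shows "measure M E \<le> measure M G + measure M (sym_diff E G)"
    and "measure M (G - E) \<le> measure M (sym_diff E G)"
proof -
  interpret prob_space M by fact
  have "measure M E \<le> measure M (G \<union> sym_diff E G)"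
    using assms by (intro finite_measure_mono) auto
  also have "\<dots> \<le> measure M G + measure M (sym_diff E G)"
    using assms by (intro measure_Un_le) auto
  finally show "measure M E \<le> measure M G + measure M (sym_diff E G)" .
  show "measure M (G - E) \<le> measure M (sym_diff E G)"
    using assms by (intro finite_measure_mono) auto
qed

text \<open>Local approximations of \<open>U\<close> and of the moved \<open>W\<close> use disjoint
  coordinates for a suitable \<open>n\<close>, so they are independent. Their intersection is nearly
  null, hence the product of the two probabilities vanishes.\<close>

lemma mixing_null:
  assumes U: "U \<in> sets (coins r)" and W: "W \<in> sets (coins r)"
    and inj: "\<And>n. inj (f n)" and away: "\<And>k. \<exists>n. f n ` window k \<inter> window k = {}"
    and null: "\<And>n :: nat. measure (coins r) (U \<inter> (\<lambda>\<xi> k. \<xi> (f n k)) -` W) = 0"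
  shows "measure (coins r) U = 0 \<or> measure (coins r) W = 0"
proof (rule ccontr)
  let ?P = "measure (coins r)"
  assume "\<not> ?thesis"
  then have pos: "?P U > 0" "?P W > 0" by (simp_all add: zero_less_measure_iff)
  \<comment> \<open>With this choice both approximations keep at least \<open>3 / 4\<close> of the
    probability, while their product is at most \<open>2 * \<epsilon>\<close>, half of the original
    product; \<open>9 / 16 > 1 / 2\<close> is the contradiction.\<close>
  define \<epsilon> where "\<epsilon> = ?P U * ?P W / 4"
  have e: "\<epsilon> > 0" using pos by (simp add: \<epsilon>_def)
  obtain k1 G where G: "G \<in> local_events r k1" "?P (sym_diff U G) < \<epsilon>"
    using coins_approximable[OF U] e unfolding approximable_def by blast
  obtain k2 H where H: "H \<in> local_events r k2" "?P (sym_diff W H) < \<epsilon>"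
    using coins_approximable[OF W] e unfolding approximable_def by blast
  define k where "k = max k1 k2"
  have dG: "G \<in> sets (coins r)" "depends_on (window k) G"
    using G(1) depends_on_mono[OF _ window_mono[of k1 k]] by (auto simp: local_events_def k_def)
  have dH: "H \<in> sets (coins r)" "depends_on (window k) H"
    using H(1) depends_on_mono[OF _ window_mono[of k2 k]] by (auto simp: local_events_def k_def)
  obtain n where n: "f n ` window k \<inter> window k = {}" using away by blast
  let ?T = "\<lambda>\<xi> :: int \<Rightarrow> int. \<lambda>k. \<xi> (f n k)"
  have T: "?P (?T -` E) = ?P E" "?T -` E \<in> sets (coins r)" if "E \<in> sets (coins r)" for E
    using measure_coins_reindex[OF inj that] sets_coins_reindex[OF that] by auto
  have "depends_on (f n ` window k) (?T -` H)"
    using dH(2) unfolding depends_on_def by auto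
  then have "?P G * ?P H = ?P (G \<inter> ?T -` H)"
    using coins_indep[of "window k" "f n ` window k" G r "?T -` H"] n dG dH T(1)[OF dH(1)] T(2)[OF dH(1)] by (simp add: Int_commute)
  \<comment> \<open>A point of \<open>G\<close> that is moved into \<open>H\<close> is either in
    \<open>U\<close> and moved into \<open>W\<close>, or witnesses one of the two approximation
    errors.\<close>
  also have "\<dots> \<le> ?P ((U \<inter> ?T -` W) \<union> ((G - U) \<union> ?T -` (H - W)))"
    using U W dG dH T by (intro coins.finite_measure_mono) auto
  also have "\<dots> \<le> ?P (U \<inter> ?T -` W) + ?P ((G - U) \<union> ?T -` (H - W))"
    using U W dG dH T by (intro measure_Un_le) auto
  also have "\<dots> \<le> ?P (U \<inter> ?T -` W) + (?P (G - U) + ?P (?T -` (H - W)))"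
    using U W dG dH T by (intro add_left_mono measure_Un_le) auto
  also have "\<dots> \<le> \<epsilon> + \<epsilon>"
    using null[of n] T[of "H - W"] measure_sym_diff_bounds(2)[OF prob_space_coins U dG(1)]
      measure_sym_diff_bounds(2)[OF prob_space_coins W dH(1)] G(2) H(2) W dH by simp
  finally have 1: "?P G * ?P H \<le> 2 * \<epsilon>" by simp
  have le1: "?P U \<le> 1" "?P W \<le> 1" by auto
  have "?P U - \<epsilon> \<le> ?P G" "?P W - \<epsilon> \<le> ?P H"
    using measure_sym_diff_bounds(1)[OF prob_space_coins U dG(1)]
      measure_sym_diff_bounds(1)[OF prob_space_coins W dH(1)] G(2) H(2) by auto
  moreover have "\<epsilon> \<le> ?P U / 4" "\<epsilon> \<le> ?P W / 4"
    using pos le1 by (simp_all add: \<epsilon>_def mult_left_le mult_left_le_one_le)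
  ultimately have "3 / 4 * ?P U \<le> ?P G" "3 / 4 * ?P W \<le> ?P H" by auto
  then have "(3 / 4 * ?P U) * (3 / 4 * ?P W) \<le> ?P G * ?P H"
    using pos by (intro mult_mono) auto
  moreover have "?P U * ?P W > 0" using pos by simp
  ultimately show False using 1 by (simp add: \<epsilon>_def)
qed

section \<open>Drift, cuts and oscillation of the walks\<close>

lemma measurable_count_space2:
  fixes f g :: "'a \<Rightarrow> 'b::countable"
  assumes "f \<in> M \<rightarrow>\<^sub>M count_space UNIV" "g \<in> M \<rightarrow>\<^sub>M count_space UNIV"
  shows "(\<lambda>x. h (f x) (g x)) \<in> M \<rightarrow>\<^sub>M count_space UNIV"
proof (rule measurable_compose_countable[OF _ assms(1)])
  show "(\<lambda>x. h i (g x)) \<in> M \<rightarrow>\<^sub>M count_space UNIV" for i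
    using measurable_compose[OF assms(2), of "h i"] by simp
qed

lemma measurable_sum_coords:
  assumes "finite A"
  shows "(\<lambda>\<xi>. \<Sum>i\<in>A. \<xi> i) \<in> coins r \<rightarrow>\<^sub>M count_space UNIV"
  using assms
proof induction
  case (insert a A)
  then show ?case
    using measurable_count_space2[OF measurable_coord insert.IH, of "(+)" a] by simp
qed simp

lemma measurable_walk [measurable]: "(\<lambda>\<xi>. walk \<xi> x) \<in> coins r \<rightarrow>\<^sub>M count_space UNIV"
  unfolding walk_def
  by (rule measurable_count_space2[of _ _ _ "(-)"]) (rule measurable_sum_coords, simp)+

lemma pred_count_space:
  assumes "f \<in> M \<rightarrow>\<^sub>M count_space UNIV"
  shows "Measurable.pred M (\<lambda>x. P (f x))"
  using measurable_compose[OF assms, of P] by simp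

lemma pred_count_space2:
  fixes f g :: "'a \<Rightarrow> 'b::countable"
  assumes "f \<in> M \<rightarrow>\<^sub>M count_space UNIV" "g \<in> M \<rightarrow>\<^sub>M count_space UNIV"
  shows "Measurable.pred M (\<lambda>x. P (f x) (g x))"
proof (rule measurable_compose_countable[OF _ assms(1)])
  show "Measurable.pred M (\<lambda>x. P i (g x))" for i
    by (rule pred_count_space[OF assms(2)])
qed

lemma pred_cut [measurable]: "Measurable.pred (coins r) (\<lambda>\<xi>. cut \<xi> x)"
  unfolding cut_def
  using pred_count_space2[OF measurable_walk measurable_walk, where P = "(\<le>)"]
    pred_count_space2[OF measurable_walk measurable_walk, where P = "(<)"]
  by (intro pred_intros_logic pred_intros_countable) auto

lemma sets_coins_Collect: "Measurable.pred (coins r) P \<Longrightarrow> {\<xi>. P \<xi>} \<in> sets (coins r)"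
  using predE by fastforce

lemma expectation_coord:
  assumes "0 \<le> r" "r \<le> 1"
  shows "integral\<^sup>L (coins r) (\<lambda>\<xi>. real_of_int (\<xi> k)) = 2 * r - 1"
proof -
  have "integral\<^sup>L (coins r) (\<lambda>\<xi>. real_of_int (\<xi> k)) = integral\<^sup>L (distr (coins r) (coin r) (\<lambda>\<xi>. \<xi> k)) real_of_int"
    unfolding coins_def by (rule integral_distr[symmetric]) (simp, simp add: coin_def)
  also have "distr (coins r) (coin r) (\<lambda>\<xi>. \<xi> k) = coin r"
    unfolding coins_def by (rule distr_PiM_component) simp_all
  also have "integral\<^sup>L (coin r) real_of_int = 2 * r - 1"
    using assms unfolding coin_def by simp
  finally show ?thesis .
qed

lemma walk_deviation:
  assumes r: "1 / 2 < r" "r \<le> 1" and n: "n > 0"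
  shows "measure (coins r) {\<xi>. real_of_int (walk \<xi> (int n)) \<le> n * (2 * r - 1) / 2}
    \<le> exp (- (2 * r - 1)\<^sup>2 / 8) ^ n"
proof -
  interpret H: Hoeffding_ineq "coins r" "{0..<int n}" "\<lambda>i \<xi>. real_of_int (\<xi> i)" "\<lambda>_. -1" "\<lambda>_. 1"
    "real n * (2 * r - 1)"
  proof unfold_locales
    have "coins.indep_vars r (\<lambda>_. borel) (\<lambda>i \<xi>. real_of_int (\<xi> i)) UNIV"
      by (rule coins.indep_vars_compose2[OF indep_coords]) (simp add: coin_def)
    then show "coins.indep_vars r (\<lambda>_. borel) (\<lambda>i \<xi>. real_of_int (\<xi> i)) {0..<int n}"
      by (rule coins.indep_vars_subset) simp
    show "AE x in coins r. real_of_int (x i) \<in> {- 1..1}" for i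
      using AE_coins_pm[of r]
    proof eventually_elim
      case (elim \<xi>)
      then have "\<xi> i = 1 \<or> \<xi> i = -1" by (simp add: pm_def)
      then show ?case by auto
    qed
    show "real n * (2 * r - 1) \<equiv> \<Sum>i\<in>{0..<int n}. integral\<^sup>L (coins r) (\<lambda>x. real_of_int (x i))"
      using r by (simp add: expectation_coord)
  qed simp
  have w: "real_of_int (walk \<xi> (int n)) = (\<Sum>i\<in>{0..<int n}. real_of_int (\<xi> i))" for \<xi>
    by (simp add: walk_def)
  \<comment> \<open>Half of the mean. The signs range over intervals of length \<open>2\<close>, so
    Hoeffding's exponent is \<open>- 2 * d\<^sup>2 / (4 * n)\<close>.\<close>
  define d where "d = real n * (2 * r - 1) / 2"
  have d: "d \<ge> 0" "real n * (2 * r - 1) - d = n * (2 * r - 1) / 2"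
    using r by (simp_all add: d_def)
  have "measure (coins r) {\<xi>. real_of_int (walk \<xi> (int n)) \<le> n * (2 * r - 1) / 2}
      \<le> exp (- 2 * d\<^sup>2 / (\<Sum>i\<in>{0..<int n}. (1 - (- 1))\<^sup>2))"
    using H.Hoeffding_ineq_le[OF d(1)] n unfolding w d(2) by simp
  also have "- 2 * d\<^sup>2 / (\<Sum>i\<in>{0..<int n}. (1 - (- 1))\<^sup>2) = real n * (- (2 * r - 1)\<^sup>2 / 8)"
    using n by (simp add: d_def power2_eq_square field_simps)
  finally show ?thesis by (simp only: exp_of_nat_mult)
qed

text \<open>The Hoeffding bound is summable, so by Borel-Cantelli the walk eventually exceeds half
  of its mean, which grows linearly.\<close>

lemma AE_walk_at_top:
  assumes r: "1 / 2 < r" "r \<le> 1"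
  shows "AE \<xi> in coins r. filterlim (walk \<xi>) at_top at_top"
proof -
  define A where "A n = {\<xi>. real_of_int (walk \<xi> (int n)) \<le> n * (2 * r - 1) / 2}" for n
  have A: "A n \<in> sets (coins r)" for n
    unfolding A_def
    by (rule sets_coins_Collect) (rule pred_count_space[OF measurable_walk])
  have "summable (\<lambda>n. measure (coins r) (A (Suc n)))"
  proof (rule summable_comparison_test)
    have "exp (- (2 * r - 1)\<^sup>2 / 8) < 1" using r by simp
    then show "summable (\<lambda>n. exp (- (2 * r - 1)\<^sup>2 / 8) ^ Suc n)"
      unfolding summable_Suc_iff by (intro summable_geometric) simp
    show "\<exists>N. \<forall>n\<ge>N. norm (measure (coins r) (A (Suc n))) \<le> exp (- (2 * r - 1)\<^sup>2 / 8) ^ Suc n"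
      using walk_deviation[OF r, of "Suc _"] unfolding A_def by simp
  qed
  then have "summable (\<lambda>n. measure (coins r) (A n))"
    using summable_Suc_iff[of "\<lambda>n. measure (coins r) (A n)"] by blast
  with A have "AE \<xi> in coins r. eventually (\<lambda>n. \<xi> \<in> space (coins r) - A n) sequentially"
    by (intro borel_cantelli_AE1) (simp_all add: coins.emeasure_eq_measure)
  then show ?thesis
  proof eventually_elim
    case (elim \<xi>)
    have lim: "filterlim (\<lambda>n. real n * (2 * r - 1) / 2) at_top sequentially"
    proof -
      have "filterlim (\<lambda>n. ((2 * r - 1) / 2) * real n) at_top sequentially"
        using r by (intro filterlim_tendsto_pos_mult_at_top[OF tendsto_const _ filterlim_real_sequentially]) simp
      then show ?thesis by (simp add: mult.commute)
    qed
    have "filterlim (\<lambda>n. walk \<xi> (int n)) at_top sequentially"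
      unfolding filterlim_at_top
    proof
      fix Z
      have "eventually (\<lambda>n. real_of_int Z \<le> real n * (2 * r - 1) / 2) sequentially"
        using lim unfolding filterlim_at_top by blast
      with elim show "eventually (\<lambda>n. Z \<le> walk \<xi> (int n)) sequentially"
        by eventually_elim (simp add: A_def)
    qed
    then show ?case by (rule filterlim_int_of_nat_at_topD)
  qed
qed

text \<open>\<open>f k\<close> belongs to the step from \<open>k\<close> to \<open>k + 1\<close>;
  reversing the line turns it into the step from \<open>- 1 - k\<close> to \<open>- k\<close>,
  whence the index \<open>- 1 - k\<close>. This deduces the behaviour at \<open>-\<infinity>\<close>
  from that at \<open>+\<infinity>\<close>.\<close>

lemma walk_reflect: "walk (\<lambda>k. f (- 1 - k)) x = - walk f (- x)"
proof (induction x rule: int_induct[where k = 0])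
  case (step1 i)
  then show ?case
    using walk_Suc[of "\<lambda>k. f (- 1 - k)" i] walk_Suc[of f "- 1 - i"] by (simp add: algebra_simps)
next
  case (step2 i)
  then show ?case
    using walk_Suc[of "\<lambda>k. f (- 1 - k)" "i - 1"] walk_Suc[of f "- i"] by (simp add: algebra_simps)
qed simp

lemma AE_drifting:
  assumes r: "1 / 2 < r" "r \<le> 1"
  shows "AE \<xi> in coins r. drifting \<xi>"
proof -
  have "inj (\<lambda>k :: int. - 1 - k)" by (simp add: inj_def)
  from AE_coins_reindex[OF this AE_walk_at_top[OF r]] AE_walk_at_top[OF r] AE_coins_pm[of r]
  show ?thesis
  proof eventually_elim
    case (elim \<xi>)
    have "filterlim (walk \<xi>) at_bot at_bot"
      unfolding filterlim_at_bot
    proof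
      fix Z
      have "eventually (\<lambda>x. - Z \<le> - walk \<xi> (- x)) at_top"
        using elim(1) unfolding filterlim_at_top walk_reflect by blast
      then obtain b where b: "\<And>x. x \<ge> b \<Longrightarrow> walk \<xi> (- x) \<le> Z"
        by (auto simp: eventually_at_top_linorder)
      have "walk \<xi> x \<le> Z" if "x \<le> - b" for x using b[of "- x"] that by simp
      then show "eventually (\<lambda>x. walk \<xi> x \<le> Z) at_bot"
        unfolding eventually_at_bot_linorder by blast
    qed
    with elim show ?case by (simp add: drifting_def)
  qed
qed

section \<open>Cuts have positive probability\<close>

lemma measure_pos_of_AE_shift:
  assumes "E \<in> sets (coins r)" "AE \<xi> in coins r. \<exists>x. shift x \<xi> \<in> E"
  shows "measure (coins r) E > 0"
proof (rule ccontr)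
  assume "\<not> ?thesis"
  then have "measure (coins r) E = 0" by (simp add: zero_less_measure_iff)
  then have "AE \<xi> in coins r. \<xi> \<notin> E"
    using assms(1) by (simp add: coins.prob_eq_0)
  moreover have "inj (\<lambda>k. k + x)" for x :: int by (simp add: inj_def)
  ultimately have "AE \<xi> in coins r. shift x \<xi> \<notin> E" for x
    unfolding shift_def using AE_coins_reindex by blast
  then have "AE \<xi> in coins r. \<forall>x. shift x \<xi> \<notin> E" by (simp add: AE_all_countable)
  with assms(2) have "AE \<xi> in coins r. False" by eventually_elim blast
  then show False by simp
qed

text \<open>The last minimizer of the walk over the nonnegative times works. It exists since the
  drift leaves only finitely many such times with nonpositive height, and \<open>0\<close> is one of
  them.\<close>

lemma drifting_last_low:
  assumes "drifting \<xi>"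
  shows "\<exists>x. \<forall>z>x. walk \<xi> x < walk \<xi> z"
proof -
  obtain b where b: "\<And>x. x \<ge> b \<Longrightarrow> 1 \<le> walk \<xi> x"
    using assms unfolding drifting_def filterlim_at_top eventually_at_top_linorder by blast
  define X where "X = {x. 0 \<le> x \<and> walk \<xi> x \<le> 0}"
  have "X \<subseteq> {0..b}"
  proof
    fix x assume "x \<in> X"
    then show "x \<in> {0..b}" using b[of x] by (cases "x \<le> b") (auto simp: X_def)
  qed
  then have X: "finite X" "0 \<in> X" using finite_subset by (auto simp: X_def)
  define m where "m = Min (walk \<xi> ` X)"
  define Y where "Y = {x\<in>X. walk \<xi> x = m}"
  have "m \<in> walk \<xi> ` X" unfolding m_def using X by (intro Min_in) auto
  then have Y: "finite Y" "Y \<noteq> {}" using X by (auto simp: Y_def)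
  define x where "x = Max Y"
  have x: "x \<in> Y" unfolding x_def using Y by (rule Max_in)
  have "walk \<xi> x < walk \<xi> z" if "z > x" for z
  proof (cases "walk \<xi> z \<le> 0")
    case True
    then have "z \<in> X" using that x by (auto simp: X_def Y_def)
    moreover have "z \<notin> Y" using that Max_ge[OF Y(1), of z] by (auto simp: x_def)
    moreover have "m \<le> walk \<xi> z" unfolding m_def using X \<open>z \<in> X\<close> by simp
    ultimately show ?thesis using x by (auto simp: Y_def)
  next
    case False
    then show ?thesis using x by (auto simp: X_def Y_def)
  qed
  then show ?thesis by blast
qed

lemma drifting_first_high:
  assumes "drifting \<xi>"
  shows "\<exists>x. \<forall>z\<le>x. walk \<xi> z \<le> walk \<xi> x"
proof -
  obtain b where b: "\<And>x. x \<le> b \<Longrightarrow> walk \<xi> x \<le> -1"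
    using assms unfolding drifting_def filterlim_at_bot eventually_at_bot_linorder by blast
  define X where "X = {x. x \<le> 0 \<and> 0 \<le> walk \<xi> x}"
  have "X \<subseteq> {b..0}"
  proof
    fix x assume "x \<in> X"
    then show "x \<in> {b..0}" using b[of x] by (cases "b \<le> x") (auto simp: X_def)
  qed
  then have X: "finite X" "0 \<in> X" using finite_subset by (auto simp: X_def)
  have "Max (walk \<xi> ` X) \<in> walk \<xi> ` X" using X by (intro Max_in) auto
  then obtain x where x: "x \<in> X" "walk \<xi> x = Max (walk \<xi> ` X)" by force
  have "walk \<xi> z \<le> walk \<xi> x" if "z \<le> x" for z
  proof (cases "walk \<xi> z \<ge> 0")
    case True
    then have "z \<in> X" using that x(1) by (auto simp: X_def)
    then show ?thesis unfolding x(2) using X(1) by simp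
  next
    case False
    then show ?thesis using x(1) by (auto simp: X_def)
  qed
  then show ?thesis by blast
qed

lemma walk_cong:
  assumes "\<And>i. 0 \<le> i \<Longrightarrow> i < x \<Longrightarrow> f i = g i" "\<And>i. x \<le> i \<Longrightarrow> i < 0 \<Longrightarrow> f i = g i"
  shows "walk f x = walk g x"
  unfolding walk_def using assms by (intro arg_cong2[where f = "(-)"] sum.cong) auto

text \<open>A cut at \<open>0\<close> is a condition \<open>G\<close> on the negative indices
  together with a condition \<open>H\<close> on the others, so the probabilities multiply. Each
  factor is positive because almost surely some translate of the condition holds.\<close>

lemma measure_cut_pos:
  assumes r: "1 / 2 < r" "r \<le> 1"
  shows "measure (coins r) {\<xi>. cut \<xi> 0} > 0"
proof -
  define G where "G = {\<xi>. \<forall>z\<le>0. walk \<xi> z \<le> 0}"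
  define H where "H = {\<xi>. \<forall>z>0. 0 < walk \<xi> z}"
  have "G \<in> sets (coins r)"
    unfolding G_def
    by (rule sets_coins_Collect, intro pred_intros_logic pred_intros_countable)
      (simp, rule pred_count_space[OF measurable_walk, where P = "\<lambda>x. x \<le> 0"])
  moreover have "H \<in> sets (coins r)"
    unfolding H_def
    by (rule sets_coins_Collect, intro pred_intros_logic pred_intros_countable)
      (simp, rule pred_count_space[OF measurable_walk, where P = "\<lambda>x. 0 < x"])
  ultimately have GH: "G \<in> sets (coins r)" "H \<in> sets (coins r)" .
  have "AE \<xi> in coins r. \<exists>x. shift x \<xi> \<in> G"
    using AE_drifting[OF r]
  proof eventually_elim
    case (elim \<xi>)
    then obtain x where "\<forall>z\<le>x. walk \<xi> z \<le> walk \<xi> x" using drifting_first_high by blast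
    then have "shift x \<xi> \<in> G" by (simp add: G_def walk_shift)
    then show ?case by blast
  qed
  then have "measure (coins r) G > 0" by (rule measure_pos_of_AE_shift[OF GH(1)])
  moreover have "AE \<xi> in coins r. \<exists>x. shift x \<xi> \<in> H"
    using AE_drifting[OF r]
  proof eventually_elim
    case (elim \<xi>)
    then obtain x where "\<forall>z>x. walk \<xi> x < walk \<xi> z" using drifting_last_low by blast
    then have "shift x \<xi> \<in> H" by (simp add: H_def walk_shift)
    then show ?case by blast
  qed
  then have "measure (coins r) H > 0" by (rule measure_pos_of_AE_shift[OF GH(2)])
  moreover have "measure (coins r) (G \<inter> H) = measure (coins r) G * measure (coins r) H"
  proof (rule coins_indep[of "{..<0}" "{0..}"])
    show "depends_on {..<0} G" unfolding depends_on_def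
    proof (intro allI impI)
      fix f g :: "int \<Rightarrow> int" assume "\<forall>i\<in>{..<0}. f i = g i"
      then have "walk f z = walk g z" if "z \<le> 0" for z using that by (intro walk_cong) auto
      then show "f \<in> G \<longleftrightarrow> g \<in> G" by (simp add: G_def)
    qed
    show "depends_on {0..} H" unfolding depends_on_def
    proof (intro allI impI)
      fix f g :: "int \<Rightarrow> int" assume "\<forall>i\<in>{0..}. f i = g i"
      then have "walk f z = walk g z" if "z > 0" for z using that by (intro walk_cong) auto
      then show "f \<in> H \<longleftrightarrow> g \<in> H" by (simp add: H_def)
    qed
  qed (use GH in auto)
  moreover have "{\<xi>. cut \<xi> 0} = G \<inter> H" by (auto simp: cut_def G_def H_def)
  ultimately show ?thesis by simp
qed

text \<open>The event that no translate along the progression lies in \<open>E\<close> is disjoint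
  from each translated \<open>E\<close>, so mixing makes it null. The values \<open>c = 1\<close>
  and \<open>c = -1\<close> give occurrences to the right and to the left of any point.\<close>

lemma AE_of_mixing:
  assumes E: "E \<in> sets (coins r)" "measure (coins r) E > 0" and c: "c \<noteq> 0"
  shows "AE \<xi> in coins r. \<exists>n :: nat. shift (b + c * int n) \<xi> \<in> E"
proof -
  define N where "N = {\<xi>. \<forall>n :: nat. shift (b + c * int n) \<xi> \<notin> E}"
  have inj: "inj (\<lambda>k :: int. k + a)" for a by (simp add: inj_def)
  have sh: "{\<xi>. shift a \<xi> \<in> E} \<in> sets (coins r)" for a
    using sets_coins_reindex[OF E(1), of "\<lambda>k. k + a"] by (simp add: shift_def vimage_def)
  have N_eq: "N = (\<Inter>n :: nat. UNIV - {\<xi>. shift (b + c * int n) \<xi> \<in> E})" by (auto simp: N_def)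
  have N: "N \<in> sets (coins r)"
    unfolding N_eq using sh by (intro sets.countable_INT) (auto intro!: sets.Diff)
  have "measure (coins r) N = 0 \<or> measure (coins r) E = 0"
  proof (rule mixing_null[OF N E(1), of "\<lambda>n k. k + (b + c * int n)"])
    show "\<exists>n. (\<lambda>i. i + (b + c * int n)) ` window k \<inter> window k = {}" for k
    proof
      \<comment> \<open>Windows of radius \<open>k\<close> become disjoint once the translation
        exceeds \<open>2 * k\<close>; the summand \<open>nat \<bar>b\<bar>\<close> absorbs the
        offset \<open>b\<close>.\<close>
      let ?n = "2 * k + nat \<bar>b\<bar> + 1"
      have "1 \<le> \<bar>c\<bar>" using c by linarith
      then have "1 * int ?n \<le> \<bar>c\<bar> * int ?n" by (rule mult_right_mono) simp
      then have "\<bar>c * int ?n\<bar> \<ge> int ?n" by (simp only: abs_mult abs_of_nat mult_1)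
      then have "\<bar>b + c * int ?n\<bar> > 2 * int k" by linarith
      then show "(\<lambda>i. i + (b + c * int ?n)) ` window k \<inter> window k = {}"
        by (auto simp: window_def abs_if split: if_splits)
    qed
    have "N \<inter> (\<lambda>\<xi> k. \<xi> (k + (b + c * int n))) -` E = {}" for n
      by (auto simp: N_def shift_def)
    then show "measure (coins r) (N \<inter> (\<lambda>\<xi> k. \<xi> (k + (b + c * int n))) -` E) = 0" for n
      by simp
  qed (rule inj)
  with E(2) have "measure (coins r) N = 0" by simp
  then have "AE \<xi> in coins r. \<xi> \<notin> N" using N by (simp add: coins.prob_eq_0)
  then show ?thesis by eventually_elim (simp add: N_def)
qed

lemma AE_cofinal_cuts:
  assumes r: "1 / 2 < r" "r \<le> 1"
  shows "AE \<xi> in coins r. cofinal_cuts \<xi>"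
proof -
  have E: "{\<xi>. cut \<xi> 0} \<in> sets (coins r)"
    by (rule sets_coins_Collect) (rule pred_cut)
  have *: "AE \<xi> in coins r. \<forall>b. \<exists>n :: nat. cut \<xi> (b + c * int n)" if "c \<noteq> 0" for c
    using AE_of_mixing[OF E measure_cut_pos[OF r] that] by (simp add: AE_all_countable cut_shift)
  have "(1 :: int) \<noteq> 0" "(- 1 :: int) \<noteq> 0" by simp_all
  from *[OF this(1)] *[OF this(2)] AE_drifting[OF r] show ?thesis
  proof eventually_elim
    case (elim \<xi>)
    show ?case unfolding cofinal_cuts_def
    proof
      fix m
      obtain a b where a: "\<And>x. x \<ge> a \<Longrightarrow> m + 1 \<le> walk \<xi> x" and b: "\<And>x. x \<le> b \<Longrightarrow> walk \<xi> x \<le> m - 1"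
        using elim(3) unfolding drifting_def filterlim_at_top filterlim_at_bot
          eventually_at_top_linorder eventually_at_bot_linorder by meson
      obtain n where n: "cut \<xi> (a + int n)" using elim(1) by auto
      obtain k where k: "cut \<xi> (b - int k)" using elim(2) by auto
      show "(\<exists>x. cut \<xi> x \<and> m < walk \<xi> x) \<and> (\<exists>x. cut \<xi> x \<and> walk \<xi> x < m)"
        using n k a[of "a + int n"] b[of "b - int k"] by force
    qed
  qed
qed

section \<open>Long runs of equal signs\<close>

lemma measure_coord:
  assumes "0 \<le> r" "r \<le> 1"
  shows "measure (coins r) {\<xi>. \<xi> k = 1} = r" "measure (coins r) {\<xi>. \<xi> k = -1} = 1 - r"
proof -
  have *: "measure (coins r) {\<xi>. \<xi> k = c} = measure (coin r) {c}" for c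
  proof -
    have d: "distr (coins r) (coin r) (\<lambda>\<xi>. \<xi> k) = coin r"
      unfolding coins_def by (rule distr_PiM_component) simp_all
    have m: "(\<lambda>\<xi>. \<xi> k) \<in> coins r \<rightarrow>\<^sub>M coin r"
      unfolding coins_def by (rule measurable_component_singleton) simp
    have "measure (distr (coins r) (coin r) (\<lambda>\<xi>. \<xi> k)) {c} = measure (coins r) ((\<lambda>\<xi>. \<xi> k) -` {c} \<inter> space (coins r))"
      by (rule measure_distr[OF m]) simp
    then show ?thesis unfolding d by (simp add: vimage_def)
  qed
  show "measure (coins r) {\<xi>. \<xi> k = 1} = r" "measure (coins r) {\<xi>. \<xi> k = -1} = 1 - r"
    unfolding * using assms by (simp_all add: measure_coin_1 measure_coin_m1)
qed

lemma sets_coord: "{\<xi>. \<xi> k = c} \<in> sets (coins r)"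
  by (rule sets_coins_Collect) (rule pred_count_space[OF measurable_coord])

lemma measure_run_pos:
  assumes "0 < r" "r < 1" "e = 1 \<or> e = -1"
  shows "measure (coins r) {\<xi>. \<forall>i\<in>{0..<int n}. \<xi> i = e} > 0"
proof (induction n)
  case 0
  then show ?case using coins.prob_space by simp
next
  case (Suc n)
  let ?R = "\<lambda>n. {\<xi> :: int \<Rightarrow> int. \<forall>i\<in>{0..<int n}. \<xi> i = e}"
  have R: "?R m \<in> sets (coins r)" for m
    by (rule sets_coins_Collect, intro pred_intros_finite, simp, rule pred_count_space[OF measurable_coord])
  have "{0..<int (Suc n)} = insert (int n) {0..<int n}" by auto
  then have eq: "?R (Suc n) = ?R n \<inter> {\<xi>. \<xi> (int n) = e}" by auto
  have "measure (coins r) (?R (Suc n)) = measure (coins r) (?R n) * measure (coins r) {\<xi>. \<xi> (int n) = e}"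
    unfolding eq
    by (rule coins_indep[of "{0..<int n}" "{int n}"]) (auto simp: depends_on_def intro: R sets_coord)
  moreover have "measure (coins r) {\<xi>. \<xi> (int n) = e} > 0"
    using assms measure_coord[of r "int n"] by auto
  ultimately show ?case using Suc by simp
qed

lemma walk_run:
  assumes "\<forall>i\<in>{0..<int n}. \<eta> (y + i) = e"
  shows "walk \<eta> (y + int n) = walk \<eta> y + e * int n"
  using assms
proof (induction n)
  case (Suc n)
  then have "walk \<eta> (y + int n) = walk \<eta> y + e * int n" "\<eta> (y + int n) = e" by auto
  then show ?case using walk_Suc[of \<eta> "y + int n"] by (simp add: algebra_simps)
qed simp

text \<open>Runs of \<open>1\<close> of every length occur far out on both sides, whether or not the
  walk drifts. A run of length \<open>2 * \<bar>m\<bar> + 2\<close> changes the height by more than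
  \<open>2 * \<bar>m\<bar>\<close>, so one of its ends has modulus above \<open>m\<close>.\<close>

lemma AE_unbounded_walk:
  assumes "0 < r" "r < 1"
  shows "AE \<eta> in coins r. unbounded_walk \<eta>"
proof -
  let ?R = "\<lambda>n. {\<xi> :: int \<Rightarrow> int. \<forall>i\<in>{0..<int n}. \<xi> i = 1}"
  have R: "?R m \<in> sets (coins r)" for m
    by (rule sets_coins_Collect, intro pred_intros_finite, simp, rule pred_count_space[OF measurable_coord])
  have *: "AE \<eta> in coins r. \<forall>L b. \<exists>n :: nat. shift (b + c * int n) \<eta> \<in> ?R L" if "c \<noteq> 0" for c
    using AE_of_mixing[OF R measure_run_pos[OF assms] that] by (simp add: AE_all_countable)
  have "(1 :: int) \<noteq> 0" "(- 1 :: int) \<noteq> 0" by simp_all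
  from *[OF this(1)] *[OF this(2)] show ?thesis
  proof eventually_elim
    case (elim \<eta>)
    have big: "m < \<bar>walk \<eta> y\<bar> \<or> m < \<bar>walk \<eta> (y + int (nat (2 * \<bar>m\<bar> + 2)))\<bar>"
      if "shift y \<eta> \<in> ?R (nat (2 * \<bar>m\<bar> + 2))" for y m
      using walk_run[of "nat (2 * \<bar>m\<bar> + 2)" \<eta> y 1] that by (auto simp: shift_def add.commute)
    show ?case unfolding unbounded_walk_def
    proof (intro allI conjI)
      fix j m
      let ?L = "nat (2 * \<bar>m\<bar> + 2)"
      obtain n where "shift (j + 1 + int n) \<eta> \<in> ?R ?L" using elim(1) by fastforce
      from big[OF this] show "\<exists>y>j. m < \<bar>walk \<eta> y\<bar>"
        by (elim disjE) (rule exI[of _ "j + 1 + int n"], simp, rule exI[of _ "j + 1 + int n + int ?L"], simp)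
      \<comment> \<open>The start is moved left by the length of the run, so that its right end is
        still below \<open>j\<close>.\<close>
      obtain n where "shift (j - 1 - int ?L - int n) \<eta> \<in> ?R ?L"
        using elim(2)[rule_format, of "j - 1 - int ?L" ?L] by auto
      from big[OF this] show "\<exists>y<j. m < \<bar>walk \<eta> y\<bar>"
        by (elim disjE) (rule exI[of _ "j - 1 - int ?L - int n"], simp,
            rule exI[of _ "j - 1 - int ?L - int n + int ?L"], simp)
    qed
  qed
qed

section \<open>Mass transport along a level\<close>

definition signs :: "real \<Rightarrow> real \<Rightarrow> ((int \<Rightarrow> int) \<times> (int \<Rightarrow> int)) measure" where
  "signs p q = coins p \<Otimes>\<^sub>M coins q"

interpretation signs_pair: pair_prob_space "coins p" "coins q" for p q
  by (simp add: pair_prob_space_def pair_sigma_finite_def prob_space_imp_sigma_finite)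

interpretation signs: prob_space "signs p q" for p q
  unfolding signs_def by (rule signs_pair.prob_space_axioms)

lemma space_signs [simp]: "space (signs p q) = UNIV"
  by (simp add: signs_def space_pair_measure)

lemma UNIV_signs [simp]: "UNIV \<in> sets (signs p q)"
  using sets.top[of "signs p q"] by simp

lemma measurable_fst_signs: "fst \<in> signs p q \<rightarrow>\<^sub>M coins p"
  and measurable_snd_signs: "snd \<in> signs p q \<rightarrow>\<^sub>M coins q"
  unfolding signs_def by (rule measurable_fst measurable_snd)+

lemma AE_signs_fst:
  assumes "AE \<xi> in coins p. P \<xi>"
  shows "AE \<omega> in signs p q. P (fst \<omega>)"
proof (rule AE_distrD[OF measurable_fst_signs[of p q]])
  have "distr (signs p q) (coins p) fst = coins p"
    unfolding signs_def by (rule coins.distr_pair_fst)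
  with assms show "AE \<xi> in distr (signs p q) (coins p) fst. P \<xi>" by (simp only:)
qed

lemma AE_signs_snd:
  assumes "AE \<eta> in coins q. P \<eta>"
  shows "AE \<omega> in signs p q. P (snd \<omega>)"
proof -
  obtain N where N: "{\<eta>. \<not> P \<eta>} \<subseteq> N" "N \<in> sets (coins q)" "emeasure (coins q) N = 0"
    using assms by (auto elim!: AE_E)
  show ?thesis
  proof (rule AE_I)
    show "{\<omega> \<in> space (signs p q). \<not> P (snd \<omega>)} \<subseteq> UNIV \<times> N" using N by auto
    show "emeasure (signs p q) (UNIV \<times> N) = 0"
      using N coins.emeasure_space_1[of p]
      by (simp add: signs_def coins.emeasure_pair_measure_Times)
    show "UNIV \<times> N \<in> sets (signs p q)" unfolding signs_def using N by auto
  qed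
qed

section \<open>Reindexing and local events for pairs of sign sequences\<close>

definition reindex2 :: "(int \<Rightarrow> int) \<Rightarrow> (int \<Rightarrow> int) \<Rightarrow> (int \<Rightarrow> 'a) \<times> (int \<Rightarrow> 'b) \<Rightarrow> (int \<Rightarrow> 'a) \<times> (int \<Rightarrow> 'b)"
  where "reindex2 f g \<omega> = (\<lambda>k. fst \<omega> (f k), \<lambda>k. snd \<omega> (g k))"

lemma measurable_reindex2: "reindex2 f g \<in> signs p q \<rightarrow>\<^sub>M signs p q"
proof -
  have "(\<lambda>\<omega>. (\<lambda>\<xi> k. \<xi> (f k)) (fst \<omega>)) \<in> signs p q \<rightarrow>\<^sub>M coins p"
    by (rule measurable_compose[OF measurable_fst_signs measurable_reindex])
  moreover have "(\<lambda>\<omega>. (\<lambda>\<xi> k. \<xi> (g k)) (snd \<omega>)) \<in> signs p q \<rightarrow>\<^sub>M coins q"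
    by (rule measurable_compose[OF measurable_snd_signs measurable_reindex])
  ultimately show ?thesis
    unfolding reindex2_def[abs_def] by (subst (2) signs_def) (rule measurable_Pair)
qed

lemma distr_signs_reindex2:
  assumes "inj f" "inj g"
  shows "distr (signs p q) (signs p q) (reindex2 f g) = signs p q"
proof -
  have "distr (coins p) (coins p) (\<lambda>\<xi> k. \<xi> (f k)) \<Otimes>\<^sub>M distr (coins q) (coins q) (\<lambda>\<xi> k. \<xi> (g k))
      = distr (coins p \<Otimes>\<^sub>M coins q) (coins p \<Otimes>\<^sub>M coins q) (\<lambda>(x, y). (\<lambda>k. x (f k), \<lambda>k. y (g k)))"
    by (rule pair_measure_distr[OF measurable_reindex measurable_reindex])
      (simp add: distr_coins_reindex assms prob_space_imp_sigma_finite)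
  moreover have "reindex2 f g = (\<lambda>(x, y). (\<lambda>k. x (f k), \<lambda>k. y (g k)))"
    by (auto simp: reindex2_def)
  ultimately show ?thesis
    unfolding signs_def distr_coins_reindex[OF assms(1)] distr_coins_reindex[OF assms(2)] by metis
qed

lemma emeasure_reindex2:
  assumes "inj f" "inj g" "E \<in> sets (signs p q)"
  shows "emeasure (signs p q) (reindex2 f g -` E) = emeasure (signs p q) E"
  using emeasure_distr[OF measurable_reindex2[where f = f and g = g and p = p and q = q] assms(3)]
  unfolding distr_signs_reindex2[OF assms(1,2)] by simp

lemma measure_reindex2:
  assumes "inj f" "inj g" "E \<in> sets (signs p q)"
  shows "measure (signs p q) (reindex2 f g -` E) = measure (signs p q) E"
  using emeasure_reindex2[OF assms] by (simp add: measure_def)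

lemma sets_reindex2: "E \<in> sets (signs p q) \<Longrightarrow> reindex2 f g -` E \<in> sets (signs p q)"
  using measurable_sets[OF measurable_reindex2[where f = f and g = g and p = p and q = q]] by simp

lemma AE_reindex2:
  assumes "inj f" "inj g" "AE \<omega> in signs p q. P \<omega>"
  shows "AE \<omega> in signs p q. P (reindex2 f g \<omega>)"
  using assms(3) AE_distrD[OF measurable_reindex2[where f = f and g = g and p = p and q = q], of P]
  unfolding distr_signs_reindex2[OF assms(1,2)] by simp

definition shift2 :: "int \<Rightarrow> int \<Rightarrow> (int \<Rightarrow> 'a) \<times> (int \<Rightarrow> 'b) \<Rightarrow> (int \<Rightarrow> 'a) \<times> (int \<Rightarrow> 'b)" where
  "shift2 x y = reindex2 (\<lambda>k. k + x) (\<lambda>k. k + y)"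

lemma shift2_eq: "shift2 x y \<omega> = (shift x (fst \<omega>), shift y (snd \<omega>))"
  by (simp add: shift2_def reindex2_def shift_def)

lemma inj_add_int: "inj (\<lambda>k :: int. k + x)"
  by (simp add: inj_def)

definition local2 :: "real \<Rightarrow> real \<Rightarrow> nat \<Rightarrow> ((int \<Rightarrow> int) \<times> (int \<Rightarrow> int)) set set" where
  "local2 p q k = {G \<in> sets (signs p q). \<forall>\<omega> \<omega>'. (\<forall>i\<in>window k. fst \<omega> i = fst \<omega>' i) \<longrightarrow>
     (\<forall>i\<in>window k. snd \<omega> i = snd \<omega>' i) \<longrightarrow> (\<omega> \<in> G \<longleftrightarrow> \<omega>' \<in> G)}"

lemma local2D:
  assumes "G \<in> local2 p q k" "\<And>i. i \<in> window k \<Longrightarrow> fst \<omega> i = fst \<omega>' i"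
    "\<And>i. i \<in> window k \<Longrightarrow> snd \<omega> i = snd \<omega>' i"
  shows "\<omega> \<in> G \<longleftrightarrow> \<omega>' \<in> G"
  using assms unfolding local2_def mem_Collect_eq by meson

lemma signs_approximable:
  assumes "E \<in> sets (signs p q)"
  shows "approximable (signs p q) (local2 p q) E"
proof (rule signs.approximable_sigma_sets[where \<G> = "{a \<times> b | a b. a \<in> sets (coins p) \<and> b \<in> sets (coins q)}"])
  show mono: "mono (local2 p q)"
  proof (rule monoI, rule subsetI)
    fix k l :: nat and G assume kl: "k \<le> l" and G: "G \<in> local2 p q k"
    have "\<omega> \<in> G \<longleftrightarrow> \<omega>' \<in> G" if "\<forall>i\<in>window l. fst \<omega> i = fst \<omega>' i" "\<forall>i\<in>window l. snd \<omega> i = snd \<omega>' i" for \<omega> \<omega>'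
      using that window_mono[OF kl] by (intro local2D[OF G]) auto
    then show "G \<in> local2 p q l" using G by (simp add: local2_def)
  qed
  show "space (signs p q) - A \<in> local2 p q k" if A: "A \<in> local2 p q k" for k A
  proof -
    have "space (signs p q) - A \<in> sets (signs p q)" using A by (intro sets.Diff) (auto simp: local2_def)
    with A show ?thesis by (simp add: local2_def)
  qed
  show "A \<union> B \<in> local2 p q k" if A: "A \<in> local2 p q k" and B: "B \<in> local2 p q k" for k A B
  proof -
    have "A \<union> B \<in> sets (signs p q)" using A B by (intro sets.Un) (auto simp: local2_def)
    moreover have "\<omega> \<in> A \<union> B \<longleftrightarrow> \<omega>' \<in> A \<union> B"
      if "\<forall>i\<in>window k. fst \<omega> i = fst \<omega>' i" "\<forall>i\<in>window k. snd \<omega> i = snd \<omega>' i" for \<omega> \<omega>'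
      using local2D[OF A, of \<omega> \<omega>'] local2D[OF B, of \<omega> \<omega>'] that by simp
    ultimately show ?thesis by (simp add: local2_def)
  qed
  show "sets (signs p q) = sigma_sets (space (signs p q)) {a \<times> b | a b. a \<in> sets (coins p) \<and> b \<in> sets (coins q)}"
    unfolding signs_def sets_pair_measure space_pair_measure ..
  show "approximable (signs p q) (local2 p q) g"
    if g: "g \<in> {a \<times> b | a b. a \<in> sets (coins p) \<and> b \<in> sets (coins q)}" for g
    unfolding approximable_def
  proof (intro allI impI)
    fix \<epsilon> :: real assume e: "\<epsilon> > 0"
    obtain a b where ab: "g = a \<times> b" "a \<in> sets (coins p)" "b \<in> sets (coins q)" using g by blast
    obtain k1 a' where a': "a' \<in> local_events p k1" "measure (coins p) (sym_diff a a') < \<epsilon> / 2"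
      using coins_approximable[OF ab(2)] e unfolding approximable_def by (meson half_gt_zero)
    obtain k2 b' where b': "b' \<in> local_events q k2" "measure (coins q) (sym_diff b b') < \<epsilon> / 2"
      using coins_approximable[OF ab(3)] e unfolding approximable_def by (meson half_gt_zero)
    have s: "a' \<in> sets (coins p)" "b' \<in> sets (coins q)" using a' b' by (auto simp: local_events_def)
    define k where "k = max k1 k2"
    have da: "depends_on (window k) a'"
      using a'(1) unfolding local_events_def mem_Collect_eq
      by (elim conjE) (erule depends_on_mono, rule window_mono, simp add: k_def)
    have db: "depends_on (window k) b'"
      using b'(1) unfolding local_events_def mem_Collect_eq
      by (elim conjE) (erule depends_on_mono, rule window_mono, simp add: k_def)
    have "a' \<times> b' \<in> sets (signs p q)" unfolding signs_def using s by blast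
    moreover have "\<omega> \<in> a' \<times> b' \<longleftrightarrow> \<omega>' \<in> a' \<times> b'"
      if "\<forall>i\<in>window k. fst \<omega> i = fst \<omega>' i" "\<forall>i\<in>window k. snd \<omega> i = snd \<omega>' i" for \<omega> \<omega>'
      using da[unfolded depends_on_def, rule_format, of "fst \<omega>" "fst \<omega>'"]
        db[unfolded depends_on_def, rule_format, of "snd \<omega>" "snd \<omega>'"] that by (simp add: mem_Times_iff)
    ultimately have loc: "a' \<times> b' \<in> local2 p q k" unfolding local2_def by blast
    have sd: "sym_diff a a' \<in> sets (coins p)" "sym_diff b b' \<in> sets (coins q)" using s ab by auto
    have mt: "measure (signs p q) (A \<times> UNIV) = measure (coins p) A" if "A \<in> sets (coins p)" for A
      using that coins.emeasure_space_1[of q]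
      by (simp add: measure_def signs_def coins.emeasure_pair_measure_Times)
    have mt': "measure (signs p q) (UNIV \<times> B) = measure (coins q) B" if "B \<in> sets (coins q)" for B
      using that coins.emeasure_space_1[of p]
      by (simp add: measure_def signs_def coins.emeasure_pair_measure_Times)
    have ss: "sym_diff a a' \<times> UNIV \<in> sets (signs p q)" "UNIV \<times> sym_diff b b' \<in> sets (signs p q)"
      unfolding signs_def by (intro pair_measureI sd UNIV_coins)+
    have "measure (signs p q) (sym_diff g (a' \<times> b'))
        \<le> measure (signs p q) (sym_diff a a' \<times> UNIV \<union> UNIV \<times> sym_diff b b')"
      using ss unfolding ab(1) by (intro signs.finite_measure_mono) auto
    also have "\<dots> \<le> measure (signs p q) (sym_diff a a' \<times> UNIV) + measure (signs p q) (UNIV \<times> sym_diff b b')"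
      by (rule measure_Un_le[OF ss])
    also have "\<dots> < \<epsilon>" unfolding mt[OF sd(1)] mt'[OF sd(2)] using a' b' by simp
    finally show "\<exists>k. \<exists>G\<in>local2 p q k. measure (signs p q) (sym_diff g G) < \<epsilon>"
      using loc by blast
  qed
qed (use assms in \<open>auto simp: local2_def\<close>)

lemma sets_signs_Collect: "Measurable.pred (signs p q) P \<Longrightarrow> {\<omega>. P \<omega>} \<in> sets (signs p q)"
  using predE by fastforce

lemma walk_fst_measurable: "(\<lambda>\<omega>. walk (fst \<omega>) x) \<in> signs p q \<rightarrow>\<^sub>M count_space UNIV"
  by (rule measurable_compose[OF measurable_fst_signs measurable_walk])

lemma walk_snd_measurable: "(\<lambda>\<omega>. walk (snd \<omega>) x) \<in> signs p q \<rightarrow>\<^sub>M count_space UNIV"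
  by (rule measurable_compose[OF measurable_snd_signs measurable_walk])

lemma sets_level: "{\<omega>. walk (fst \<omega>) x + walk (snd \<omega>) y = c} \<in> sets (signs p q)"
  by (rule sets_signs_Collect)
    (rule pred_count_space2[OF walk_fst_measurable walk_snd_measurable, where P = "\<lambda>a b. a + b = c"])

lemma sets_cut: "{\<omega>. cut (fst \<omega>) x} \<in> sets (signs p q)"
  by (rule sets_signs_Collect) (rule measurable_compose[OF measurable_fst_signs pred_cut])

text \<open>Since \<open>walk (fst \<omega>) 0 = 0\<close>, column \<open>0\<close> is the last
  visit to height \<open>0\<close>. This is the future half of a cut at \<open>0\<close>.\<close>

definition last_visit :: "((int \<Rightarrow> int) \<times> 'b) set" where
  "last_visit = {\<omega>. \<forall>z>0. 0 < walk (fst \<omega>) z}"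

lemma sets_last_visit: "last_visit \<in> sets (signs p q)"
  unfolding last_visit_def
  by (rule sets_signs_Collect, intro pred_intros_logic pred_intros_countable)
    (simp, rule pred_count_space[OF walk_fst_measurable, where P = "\<lambda>x. 0 < x"])

lemma shift2_last_visit: "shift2 x y \<omega> \<in> last_visit \<longleftrightarrow> (\<forall>z>x. walk (fst \<omega>) x < walk (fst \<omega>) z)"
proof -
  have "shift2 x y \<omega> \<in> last_visit \<longleftrightarrow> (\<forall>z>0. walk (fst \<omega>) x < walk (fst \<omega>) (z + x))"
    by (simp add: last_visit_def shift2_eq walk_shift)
  also have "\<dots> \<longleftrightarrow> (\<forall>z>x. walk (fst \<omega>) x < walk (fst \<omega>) z)"
    by (metis add_less_cancel_right diff_add_cancel add_0)
  finally show ?thesis .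
qed

lemma last_visit_unique:
  assumes "shift2 x y \<omega> \<in> last_visit" "shift2 x' y' \<omega> \<in> last_visit" "walk (fst \<omega>) x = walk (fst \<omega>) x'"
  shows "x = x'"
proof (rule ccontr)
  assume "x \<noteq> x'"
  then consider "x < x'" | "x' < x" by linarith
  then show False using assms unfolding shift2_last_visit by cases (metis less_irrefl)+
qed

text \<open>Both walks start at \<open>0\<close>, so the vanishing sum says that
  \<open>(x, y)\<close> has the level of the origin: \<open>D\<close> holds as seen from the last
  visit of this level in row \<open>y\<close>.\<close>

definition seen :: "int \<Rightarrow> ((int \<Rightarrow> int) \<times> (int \<Rightarrow> int)) set \<Rightarrow> ((int \<Rightarrow> int) \<times> (int \<Rightarrow> int)) set" where
  "seen y D = last_visit \<inter> (\<Union>x. {\<omega>. walk (fst \<omega>) x + walk (snd \<omega>) y = 0} \<inter> shift2 x y -` (last_visit \<inter> D))"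

lemma sets_shift2: "E \<in> sets (signs p q) \<Longrightarrow> shift2 x y -` E \<in> sets (signs p q)"
  unfolding shift2_def by (rule sets_reindex2)

lemma sets_seen: "D \<in> sets (signs p q) \<Longrightarrow> seen y D \<in> sets (signs p q)"
  unfolding seen_def
  by (intro sets.Int sets_last_visit sets.countable_UN) (auto intro!: sets.Int sets_level sets_shift2 sets_last_visit)

text \<open>Mass transport: each last visit in row \<open>0\<close> sends its mass to the last visit in row \<open>y\<close> at the
  same level, which is unique.\<close>

lemma emeasure_seen_le:
  assumes D: "D \<in> sets (signs p q)"
  shows "emeasure (signs p q) (seen y D) \<le> emeasure (signs p q) D"
proof -
  define T where "T x = last_visit \<inter> ({\<omega>. walk (fst \<omega>) x + walk (snd \<omega>) y = 0} \<inter> shift2 x y -` (last_visit \<inter> D))" for x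
  \<comment> \<open>\<open>T' x\<close> is \<open>T x\<close> seen from the receiver: the sender now
    lies at \<open>(- x, - y)\<close>. Uniqueness of the receiver makes the sets \<open>T x\<close>
    disjoint, uniqueness of the sender the sets \<open>T' x\<close>.\<close>
  define T' where "T' x = shift2 (- x) (- y) -` last_visit
    \<inter> {\<omega>. walk (fst \<omega>) (- x) + walk (snd \<omega>) (- y) = 0} \<inter> (last_visit \<inter> D)" for x
  have T: "T x \<in> sets (signs p q)" for x
    unfolding T_def by (intro sets.Int sets_level sets_last_visit sets_shift2 D)
  have T': "T' x \<in> sets (signs p q)" for x
    unfolding T'_def by (intro sets.Int sets_level sets_last_visit sets_shift2 D)
  have inv: "shift2 (- x) (- y) (shift2 x y \<omega>) = \<omega>" for x and \<omega> :: "(int \<Rightarrow> int) \<times> (int \<Rightarrow> int)"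
    by (simp add: shift2_eq)
  have "shift2 x y -` T' x = T x" for x
    unfolding T_def T'_def using inv by (auto simp: shift2_eq walk_shift)
  then have eq: "emeasure (signs p q) (T x) = emeasure (signs p q) (T' x)" for x
    using emeasure_reindex2[OF inj_add_int inj_add_int T'[of x], of x y] by (simp add: shift2_def)
  have djT: "disjoint_family T"
    unfolding disjoint_family_on_def
  proof (intro ballI impI)
    fix x x' :: int assume ne: "x \<noteq> x'"
    show "T x \<inter> T x' = {}"
    proof (rule equals0I)
      fix \<omega> assume "\<omega> \<in> T x \<inter> T x'"
      then have "shift2 x y \<omega> \<in> last_visit" "shift2 x' y \<omega> \<in> last_visit"
        "walk (fst \<omega>) x = walk (fst \<omega>) x'" by (auto simp: T_def)
      with ne show False using last_visit_unique by blast
    qed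
  qed
  have djT': "disjoint_family T'"
    unfolding disjoint_family_on_def
  proof (intro ballI impI)
    fix x x' :: int assume ne: "x \<noteq> x'"
    show "T' x \<inter> T' x' = {}"
    proof (rule equals0I)
      fix \<omega> assume "\<omega> \<in> T' x \<inter> T' x'"
      then have "shift2 (- x) (- y) \<omega> \<in> last_visit" "shift2 (- x') (- y) \<omega> \<in> last_visit"
        "walk (fst \<omega>) (- x) = walk (fst \<omega>) (- x')" by (auto simp: T'_def)
      then have "- x = - x'" by (rule last_visit_unique)
      with ne show False by simp
    qed
  qed
  have "seen y D = (\<Union>x. T x)" by (auto simp: seen_def T_def)
  then have "emeasure (signs p q) (seen y D) = (\<integral>\<^sup>+x. emeasure (signs p q) (T x) \<partial>count_space UNIV)"
    using emeasure_UN_countable[of UNIV T "signs p q"] T djT by simp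
  also have "\<dots> = (\<integral>\<^sup>+x. emeasure (signs p q) (T' x) \<partial>count_space UNIV)"
    by (simp add: eq)
  also have "\<dots> = emeasure (signs p q) (\<Union>x. T' x)"
    using emeasure_UN_countable[of UNIV T' "signs p q"] T' djT' by simp
  also have "\<dots> \<le> emeasure (signs p q) D"
    using D by (intro emeasure_mono) (auto simp: T'_def)
  finally show ?thesis .
qed

lemma measure_seen_le:
  assumes "D \<in> sets (signs p q)"
  shows "measure (signs p q) (seen y D) \<le> measure (signs p q) D"
  using emeasure_seen_le[OF assms, of y] by (simp add: signs.emeasure_eq_measure)

section \<open>The zero-one law for positive drift\<close>

lemma AE_typical:
  assumes "1 / 2 < p" "p < 1" "0 < q" "q < 1"
  shows "AE \<omega> in signs p q. typical (fst \<omega>) (snd \<omega>)"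
proof -
  have p: "1 / 2 < p" "p \<le> 1" using assms by simp_all
  from AE_signs_fst[OF AE_drifting[OF p], of q] AE_signs_fst[OF AE_cofinal_cuts[OF p], of q]
    AE_signs_snd[OF AE_coins_pm[of q], of p] AE_signs_snd[OF AE_unbounded_walk[OF assms(3,4)], of p]
  show ?thesis by eventually_elim (simp add: typical_def)
qed

definition no_cut :: "nat \<Rightarrow> ((int \<Rightarrow> int) \<times> (int \<Rightarrow> int)) set" where
  "no_cut L = (\<Inter>y\<in>{0..int L}. \<Inter>x. UNIV - ({\<omega>. cut (fst \<omega>) x} \<inter> {\<omega>. walk (fst \<omega>) x + walk (snd \<omega>) y = 0}))"

lemma no_cut_iff:
  "\<omega> \<in> no_cut L \<longleftrightarrow> (\<forall>y\<in>{0..int L}. \<forall>x. cut (fst \<omega>) x \<longrightarrow> walk (fst \<omega>) x + walk (snd \<omega>) y \<noteq> 0)"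
  by (simp add: no_cut_def)

lemma sets_no_cut: "no_cut L \<in> sets (signs p q)"
  unfolding no_cut_def
  by (rule sets.finite_INT, simp, simp, rule sets.countable_INT, auto intro!: sets.Diff sets.Int sets_cut sets_level)

lemma no_cut_vanishes:
  assumes "1 / 2 < p" "p < 1" "0 < q" "q < 1" "\<epsilon> > 0"
  shows "\<exists>L. measure (signs p q) (no_cut L) < \<epsilon>"
proof -
  have "(\<lambda>L. measure (signs p q) (no_cut L)) \<longlonglongrightarrow> measure (signs p q) (\<Inter>L. no_cut L)"
  proof (rule signs.finite_Lim_measure_decseq)
    show "range no_cut \<subseteq> signs.events p q" using sets_no_cut by blast
    show "decseq no_cut" unfolding decseq_def using no_cut_iff by fastforce
  qed
  moreover have "measure (signs p q) (\<Inter>L. no_cut L) = 0"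
  proof -
    have "AE \<omega> in signs p q. \<omega> \<notin> (\<Inter>L. no_cut L)"
      using AE_typical[OF assms(1-4)]
    proof eventually_elim
      case (elim \<omega>)
      then obtain x y where "- 1 < y" "cut (fst \<omega>) x" "walk (fst \<omega>) x + walk (snd \<omega>) y = 0"
        using cut_row_above[of "fst \<omega>" "snd \<omega>" "- 1" 0] by blast
      then have "\<omega> \<notin> no_cut (nat y)" unfolding no_cut_iff by force
      then show ?case by blast
    qed
    then show ?thesis using sets_no_cut by (subst signs.prob_eq_0) auto
  qed
  ultimately have "eventually (\<lambda>L. \<bar>measure (signs p q) (no_cut L) - 0\<bar> < \<epsilon>) sequentially"
    using assms(5) unfolding tendsto_iff dist_real_def by simp
  then obtain L where "\<bar>measure (signs p q) (no_cut L) - 0\<bar> < \<epsilon>"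
    using eventually_happens trivial_limit_sequentially by blast
  then show ?thesis by (auto simp: abs_if split: if_splits)
qed

text \<open>After the largest visit to \<open>c\<close> the walk cannot be at or below
  \<open>c\<close> again, since on its way to \<open>+\<infinity>\<close> it would pass
  \<open>c\<close> once more.\<close>

lemma drifting_last_visit:
  assumes "drifting \<xi>"
  shows "\<exists>x. walk \<xi> x = c \<and> (\<forall>z>x. c < walk \<xi> z)"
proof -
  have px: "pm \<xi>" using assms by (simp add: drifting_def)
  obtain a b where b: "\<And>x. x \<ge> b \<Longrightarrow> c + 1 \<le> walk \<xi> x" and a: "\<And>x. x \<le> a \<Longrightarrow> walk \<xi> x \<le> c"
    using assms unfolding drifting_def filterlim_at_top filterlim_at_bot
      eventually_at_top_linorder eventually_at_bot_linorder by meson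
  define X where "X = {x \<in> {min a b..b}. walk \<xi> x = c}"
  have "X \<noteq> {}"
    using walk_intermediate[OF px, of "min a b" b c] a[of "min a b"] b[of b] by (auto simp: X_def)
  moreover have fX: "finite X" by (rule finite_subset[of _ "{min a b..b}"]) (auto simp: X_def)
  ultimately have "Max X \<in> X" by simp
  moreover have "c < walk \<xi> z" if "z > Max X" for z
  proof (rule ccontr)
    assume "\<not> c < walk \<xi> z"
    then have "z < b" "walk \<xi> z \<le> c" using b[of z] by (force simp: not_less)+
    then obtain y where y: "y \<in> {z..b}" "walk \<xi> y = c"
      using walk_intermediate[OF px, of z b c] b[of b] by auto
    then have "y \<in> X" using that \<open>Max X \<in> X\<close> by (auto simp: X_def)
    then show False using Max_ge[OF fX, of y] that y by simp
  qed
  ultimately show ?thesis by (intro exI[of _ "Max X"]) (simp add: X_def)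
qed

lemma seenI:
  "\<omega> \<in> last_visit \<Longrightarrow> walk (fst \<omega>) x + walk (snd \<omega>) y = 0 \<Longrightarrow> shift2 x y \<omega> \<in> last_visit \<Longrightarrow>
    shift2 x y \<omega> \<in> D \<Longrightarrow> \<omega> \<in> seen y D"
  unfolding seen_def by blast

text \<open>Beyond the permuted rows both configurations have the same cut vertices on the line of
  the origin, with the same local surroundings there. Path invariance carries the two values of
  \<open>\<Phi>\<close> to such a vertex, where a local approximation cannot tell them apart; if
  they differ, it errs for one of them, which transport makes unlikely.\<close>

lemma row_permutation_null:
  assumes pq: "1 / 2 < p" "p < 1" "0 < q" "q < 1"
    and inv: "path_invariant \<Phi>" and meas: "{\<omega>. \<Phi> \<omega>} \<in> sets (signs p q)"
    and \<pi>: "inj \<pi>" "\<And>i. int m < i \<Longrightarrow> \<pi> i = i"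
      "\<And>\<eta> y. int m < y \<Longrightarrow> walk (\<lambda>k. \<eta> (\<pi> k)) y = walk \<eta> y"
  shows "measure (signs p q)
    {\<omega>. cut (fst \<omega>) 0 \<and> \<Phi> \<omega> \<and> \<not> \<Phi> (reindex2 (\<lambda>k. k) \<pi> \<omega>)} = 0" (is "measure _ ?B = 0")
proof -
  let ?P = "measure (signs p q)" and ?\<sigma> = "reindex2 (\<lambda>k. k) \<pi> :: (int \<Rightarrow> int) \<times> (int \<Rightarrow> int) \<Rightarrow> _"
  have B_eq: "?B = {\<omega>. cut (fst \<omega>) 0} \<inter> ({\<omega>. \<Phi> \<omega>} - ?\<sigma> -` {\<omega>. \<Phi> \<omega>})" by auto
  have Bs: "?B \<in> sets (signs p q)"
    unfolding B_eq by (intro sets.Int sets.Diff sets_cut meas sets_reindex2)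
  have "?P ?B \<le> \<epsilon>" if e: "\<epsilon> > 0" for \<epsilon>
  proof -
    \<comment> \<open>\<open>L\<close> is fixed before the local event, whose window determines the
      row \<open>N\<close>; transport bounds \<open>seen N (no_cut L)\<close> uniformly in
      \<open>N\<close>.\<close>
    obtain L where L: "?P (no_cut L) < \<epsilon> / 2" using no_cut_vanishes[OF pq, of "\<epsilon> / 2"] e by auto
    \<comment> \<open>Each of the \<open>L + 1\<close> rows contributes two errors, one for
      \<open>\<omega>\<close> and one for the permuted configuration; together they are at most
      \<open>\<epsilon> / 2\<close>.\<close>
    define \<delta> where "\<delta> = \<epsilon> / (4 * (real L + 1))"
    have d: "\<delta> > 0" using e by (simp add: \<delta>_def)
    obtain k G where G: "G \<in> local2 p q k" "?P (sym_diff {\<omega>. \<Phi> \<omega>} G) < \<delta>"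
      using signs_approximable[OF meas] d unfolding approximable_def by blast
    define D where "D = sym_diff {\<omega>. \<Phi> \<omega>} G"
    have "G \<in> sets (signs p q)" using G by (simp add: local2_def)
    then have D: "D \<in> sets (signs p q)" unfolding D_def using meas by auto
    \<comment> \<open>A window of radius \<open>k\<close> around a row from \<open>N\<close> on
      contains only rows above \<open>m\<close>, which the permutation fixes.\<close>
    define N where "N = int m + int k + 1"
    define Y where "Y = {N..N + int L}"
    have cover: "AE \<omega> in signs p q. \<omega> \<in> ?B \<longrightarrow>
        \<omega> \<in> seen N (no_cut L) \<union> (\<Union>y\<in>Y. seen y D \<union> ?\<sigma> -` seen y D)"
      using AE_typical[OF pq] AE_reindex2[OF inj_on_id2 \<pi>(1) AE_typical[OF pq]]
    proof eventually_elim
      case (elim \<omega>)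
      show ?case
      proof (rule impI)
        assume "\<omega> \<in> ?B"
        then have c0: "cut (fst \<omega>) 0" and p1: "\<Phi> \<omega>" and p2: "\<not> \<Phi> (?\<sigma> \<omega>)" by auto
        have s: "fst (?\<sigma> \<omega>) = fst \<omega>" "snd (?\<sigma> \<omega>) = (\<lambda>k. snd \<omega> (\<pi> k))"
          by (simp_all add: reindex2_def)
        have dr: "drifting (fst \<omega>)" "pm (snd \<omega>)" "pm (snd (?\<sigma> \<omega>))"
          using elim by (auto simp: typical_def)
        have lv: "\<omega> \<in> last_visit" "?\<sigma> \<omega> \<in> last_visit"
          using c0 by (auto simp: last_visit_def cut_def s)
        \<comment> \<open>The anchor in row \<open>N\<close> is a last visit, which always exists; a
          cut of the same level is then sought in the rows \<open>N\<close> to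
          \<open>N + L\<close>.\<close>
        obtain x where x: "walk (fst \<omega>) x = - walk (snd \<omega>) N" "\<forall>z>x. - walk (snd \<omega>) N < walk (fst \<omega>) z"
          using drifting_last_visit[OF dr(1)] by blast
        show "\<omega> \<in> seen N (no_cut L) \<union> (\<Union>y\<in>Y. seen y D \<union> ?\<sigma> -` seen y D)"
        proof (cases "shift2 x N \<omega> \<in> no_cut L")
          case True
          moreover have "shift2 x N \<omega> \<in> last_visit" using x by (simp add: shift2_last_visit)
          ultimately have "\<omega> \<in> seen N (no_cut L)" using lv x(1) by (intro seenI[of \<omega> x]) simp_all
          then show ?thesis by blast
        next
          case False
          then obtain y' x' where y': "y' \<in> {0..int L}" "cut (fst (shift2 x N \<omega>)) x'"
            "walk (fst (shift2 x N \<omega>)) x' + walk (snd (shift2 x N \<omega>)) y' = 0"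
            unfolding no_cut_iff by blast
          define a where "a = x' + x"
          define y where "y = y' + N"
          have ca: "cut (fst \<omega>) a" using y' by (simp add: shift2_eq cut_shift a_def)
          have lev: "walk (fst \<omega>) a + walk (snd \<omega>) y = 0"
            using y'(3) x(1) by (simp add: shift2_eq walk_shift a_def y_def)
          have yY: "y \<in> Y" using y'(1) by (simp add: Y_def y_def)
          then have ym: "y > int m + int k" by (simp add: Y_def N_def)
          have lev': "walk (fst (?\<sigma> \<omega>)) a + walk (snd (?\<sigma> \<omega>)) y = 0"
            using lev \<pi>(3)[of y] ym by (simp add: s)
          have "\<Phi> (shift2 a y \<omega>) = \<Phi> \<omega>"
            using path_invariant_cuts[OF inv dr(1,2) c0 ca, of 0 y] lev ym by (simp add: shift2_eq)
          moreover have "\<Phi> (shift2 a y (?\<sigma> \<omega>)) = \<Phi> (?\<sigma> \<omega>)"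
            using path_invariant_cuts[OF inv _ dr(3), of "fst (?\<sigma> \<omega>)" 0 a 0 y] dr(1) c0 ca lev' ym
            by (simp add: shift2_eq s) (simp add: reindex2_def)
          moreover have "shift2 a y \<omega> \<in> G \<longleftrightarrow> shift2 a y (?\<sigma> \<omega>) \<in> G"
          proof (rule local2D[OF G(1)])
            fix i assume "i \<in> window k"
            then have "\<pi> (i + y) = i + y" using ym by (intro \<pi>(2)) (auto simp: window_def)
            then show "snd (shift2 a y \<omega>) i = snd (shift2 a y (?\<sigma> \<omega>)) i"
              by (simp add: shift2_eq s shift_def)
          qed (simp add: shift2_eq s)
          \<comment> \<open>\<open>\<Phi>\<close> differs at the two recentred configurations while
            \<open>G\<close> agrees, so \<open>G\<close> is wrong at one of them.\<close>
          ultimately have "shift2 a y \<omega> \<in> D \<or> shift2 a y (?\<sigma> \<omega>) \<in> D"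
            using p1 p2 by (auto simp: D_def)
          moreover have "shift2 a y \<omega> \<in> last_visit" "shift2 a y (?\<sigma> \<omega>) \<in> last_visit"
            using ca by (auto simp: shift2_last_visit cut_def s)
          ultimately have "\<omega> \<in> seen y D \<or> ?\<sigma> \<omega> \<in> seen y D"
            using seenI lv lev lev' by blast
          then show ?thesis using yY by blast
        qed
      qed
    qed
    have S: "seen y D \<in> sets (signs p q)" "?\<sigma> -` seen y D \<in> sets (signs p q)" for y
      using sets_seen[OF D] sets_reindex2 by blast+
    have one: "?P (seen y D \<union> ?\<sigma> -` seen y D) \<le> 2 * \<delta>" for y
    proof -
      have "?P (seen y D \<union> ?\<sigma> -` seen y D) \<le> ?P (seen y D) + ?P (?\<sigma> -` seen y D)"
        by (rule measure_Un_le[OF S])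
      also have "?P (?\<sigma> -` seen y D) = ?P (seen y D)"
        by (rule measure_reindex2[OF inj_on_id2 \<pi>(1) S(1)])
      also have "?P (seen y D) + ?P (seen y D) \<le> 2 * \<delta>"
        using measure_seen_le[OF D, of y] G(2) by (simp add: D_def)
      finally show ?thesis .
    qed
    have SY: "(\<Union>y\<in>Y. seen y D \<union> ?\<sigma> -` seen y D) \<in> sets (signs p q)"
      using S by (intro sets.finite_UN) (auto simp: Y_def)
    have "?P ?B \<le> ?P (seen N (no_cut L) \<union> (\<Union>y\<in>Y. seen y D \<union> ?\<sigma> -` seen y D))"
      by (rule signs.finite_measure_mono_AE[OF cover]) (intro sets.Un SY sets_seen sets_no_cut)
    also have "\<dots> \<le> ?P (seen N (no_cut L)) + ?P (\<Union>y\<in>Y. seen y D \<union> ?\<sigma> -` seen y D)"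
      by (intro measure_Un_le SY sets_seen sets_no_cut)
    also have "?P (\<Union>y\<in>Y. seen y D \<union> ?\<sigma> -` seen y D) \<le> (\<Sum>y\<in>Y. ?P (seen y D \<union> ?\<sigma> -` seen y D))"
      using S by (intro signs.finite_measure_subadditive_finite) (auto simp: Y_def)
    also have "\<dots> \<le> (\<Sum>y\<in>Y. 2 * \<delta>)" by (rule sum_mono) (rule one)
    also have "\<dots> = \<epsilon> / 2" by (simp add: Y_def \<delta>_def field_simps)
    also have "?P (seen N (no_cut L)) \<le> \<epsilon> / 2"
      using measure_seen_le[OF sets_no_cut, of p q N L] L by simp
    finally show ?thesis by simp
  qed
  then have "?P ?B \<le> 0" using field_le_epsilon[of "?P ?B" 0] by simp
  then show ?thesis by (simp add: measure_le_0_iff)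
qed

text \<open>With \<open>c = n + 1\<close>, the block \<open>[0, c)\<close> is exchanged with
  \<open>[c, 2c)\<close> and \<open>[-c, 0)\<close> with \<open>[-2c, -c)\<close>. This moves
  \<open>window n\<close> off itself, yet never mixes negative and nonnegative indices, so the sums
  from \<open>0\<close> up to rows above all blocks survive.\<close>

definition block_swap :: "nat \<Rightarrow> int \<Rightarrow> int" where
  "block_swap n i = (let c = int n + 1 in
     if 0 \<le> i \<and> i < c then i + c else if c \<le> i \<and> i < 2 * c then i - c
     else if - c \<le> i \<and> i < 0 then i - c else if - 2 * c \<le> i \<and> i < - c then i + c else i)"

lemma block_swap_involution [simp]: "block_swap n (block_swap n i) = i"
  by (simp add: block_swap_def Let_def)

lemma inj_block_swap: "inj (block_swap n)"
  by (metis block_swap_involution injI)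

lemma block_swap_away: "block_swap n ` window n \<inter> window n = {}"
  by (auto simp: block_swap_def window_def Let_def)

lemma block_swap_outside: "2 * int n + 2 \<le> i \<Longrightarrow> block_swap n i = i"
  by (simp add: block_swap_def Let_def)

lemma walk_block_swap:
  assumes "2 * int n + 2 \<le> y"
  shows "walk (\<lambda>k. f (block_swap n k)) y = walk f y"
proof -
  have into: "block_swap n i \<in> {0..<y}" if "i \<in> {0..<y}" for i
    using that assms by (auto simp: block_swap_def Let_def)
  have "bij_betw (block_swap n) {0..<y} {0..<y}"
    by (rule bij_betw_byWitness[where f' = "block_swap n"]) (use into in auto)
  then have "(\<Sum>i\<in>{0..<y}. f (block_swap n i)) = (\<Sum>i\<in>{0..<y}. f i)"
    by (rule sum.reindex_bij_betw)
  then show ?thesis using assms by (simp add: walk_def)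
qed

text \<open>A Hewitt-Savage argument in \<open>\<eta>\<close> for fixed \<open>\<xi>\<close>: the
  section of \<open>\<Phi>\<close> is, up to null sets, never carried into its complement by a block
  swap, so mixing makes one of the two null.\<close>

lemma fibre_zero_one:
  assumes pq: "1 / 2 < p" "p < 1" "0 < q" "q < 1"
    and inv: "path_invariant \<Phi>" and meas: "{\<omega>. \<Phi> \<omega>} \<in> sets (signs p q)"
  shows "AE \<xi> in coins p. cut \<xi> 0 \<longrightarrow> (AE \<eta> in coins q. \<Phi> (\<xi>, \<eta>)) \<or> (AE \<eta> in coins q. \<not> \<Phi> (\<xi>, \<eta>))"
proof -
  have "AE \<xi> in coins p. AE \<eta> in coins q.
      \<not> (cut \<xi> 0 \<and> \<Phi> (\<xi>, \<eta>) \<and> \<not> \<Phi> (\<xi>, \<lambda>k. \<eta> (block_swap n k)))" for n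
  proof -
    let ?B = "{\<omega>. cut (fst \<omega>) 0 \<and> \<Phi> \<omega> \<and> \<not> \<Phi> (reindex2 (\<lambda>k. k) (block_swap n) \<omega>)}"
    have B_eq: "?B = {\<omega>. cut (fst \<omega>) 0} \<inter> ({\<omega>. \<Phi> \<omega>} - reindex2 (\<lambda>k. k) (block_swap n) -` {\<omega>. \<Phi> \<omega>})"
      by auto
    have "?B \<in> sets (signs p q)"
      unfolding B_eq by (intro sets.Int sets.Diff sets_cut meas sets_reindex2)
    moreover have "measure (signs p q) ?B = 0"
      by (rule row_permutation_null[OF pq inv meas inj_block_swap, of "2 * n + 2"])
        (auto intro: block_swap_outside walk_block_swap)
    ultimately have "AE \<omega> in signs p q. \<omega> \<notin> ?B" by (simp add: signs.prob_eq_0)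
    then have "AE \<xi> in coins p. AE \<eta> in coins q. (\<xi>, \<eta>) \<notin> ?B"
      unfolding signs_def by (rule signs_pair.AE_pair)
    then show ?thesis by (simp add: reindex2_def)
  qed
  then have "AE \<xi> in coins p. \<forall>n. AE \<eta> in coins q.
      \<not> (cut \<xi> 0 \<and> \<Phi> (\<xi>, \<eta>) \<and> \<not> \<Phi> (\<xi>, \<lambda>k. \<eta> (block_swap n k)))"
    by (simp only: AE_all_countable) blast
  then show ?thesis
  proof eventually_elim
    case (elim \<xi>)
    show ?case
    proof (rule impI)
      assume c: "cut \<xi> 0"
      define U where "U = Pair \<xi> -` {\<omega>. \<Phi> \<omega>}"
      have U: "U \<in> sets (coins q)"
        unfolding U_def using meas unfolding signs_def by (rule sets_Pair1)
      have W: "UNIV - U \<in> sets (coins q)" using U by (intro sets.Diff) simp_all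
      have "measure (coins q) U = 0 \<or> measure (coins q) (UNIV - U) = 0"
      proof (rule mixing_null[OF U W inj_block_swap])
        show "\<exists>n. block_swap n ` window k \<inter> window k = {}" for k
          using block_swap_away by blast
        fix n
        have "(\<lambda>\<xi> k. \<xi> (block_swap n k)) -` (UNIV - U) \<in> sets (coins q)"
          by (rule sets_coins_reindex[OF W])
        then have "U \<inter> (\<lambda>\<xi> k. \<xi> (block_swap n k)) -` (UNIV - U) \<in> sets (coins q)"
          using U by (rule sets.Int[rotated])
        moreover have "AE \<eta> in coins q. \<eta> \<notin> U \<inter> (\<lambda>\<xi> k. \<xi> (block_swap n k)) -` (UNIV - U)"
          using elim[rule_format, of n] by eventually_elim (simp add: U_def c)
        ultimately show "measure (coins q) (U \<inter> (\<lambda>\<xi> k. \<xi> (block_swap n k)) -` (UNIV - U)) = 0"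
          by (simp add: coins.prob_eq_0)
      qed
      then have "(AE \<eta> in coins q. \<eta> \<notin> U) \<or> (AE \<eta> in coins q. \<eta> \<notin> UNIV - U)"
        using U W by (simp add: coins.prob_eq_0)
      then show "(AE \<eta> in coins q. \<Phi> (\<xi>, \<eta>)) \<or> (AE \<eta> in coins q. \<not> \<Phi> (\<xi>, \<eta>))"
        by (auto simp: U_def)
    qed
  qed
qed

section \<open>From single fibres to all cuts and all infinite lines\<close>

lemma sets_AE_fibre:
  assumes "{\<omega>. \<Phi> \<omega>} \<in> sets (signs p q)"
  shows "{\<xi>. AE \<eta> in coins q. \<not> \<Phi> (\<xi>, \<eta>)} \<in> sets (coins p)"
proof -
  have F: "{\<omega>. \<Phi> \<omega>} \<in> sets (coins p \<Otimes>\<^sub>M coins q)" using assms by (simp add: signs_def)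
  have "(AE \<eta> in coins q. \<not> \<Phi> (\<xi>, \<eta>)) \<longleftrightarrow> emeasure (coins q) (Pair \<xi> -` {\<omega>. \<Phi> \<omega>}) = 0" for \<xi>
    using sets_Pair1[OF F, of \<xi>] by (subst AE_iff_measurable[of "Pair \<xi> -` {\<omega>. \<Phi> \<omega>}"]) auto
  moreover have "(\<lambda>\<xi>. emeasure (coins q) (Pair \<xi> -` {\<omega>. \<Phi> \<omega>})) -` {0} \<inter> space (coins p) \<in> sets (coins p)"
    by (rule measurable_sets[OF coins.measurable_emeasure_Pair[OF F]]) simp
  ultimately show ?thesis by (simp add: vimage_def)
qed

lemma path_invariant_not: "path_invariant \<Phi> \<Longrightarrow> path_invariant (\<lambda>\<omega>. \<not> \<Phi> \<omega>)"
  unfolding path_invariant_def by blast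

text \<open>If both values were possible at cuts, some \<open>\<xi>\<close> would have a cut at \<open>0\<close> where \<open>\<Phi>\<close> holds for
  almost every \<open>\<eta>\<close> and another one where it fails for almost every \<open>\<eta>\<close>; but the two cut vertices lie
  on a common path with positive probability.\<close>

lemma cut_zero_one:
  assumes pq: "1 / 2 < p" "p < 1" "0 < q" "q < 1"
    and inv: "path_invariant \<Phi>" and meas: "{\<omega>. \<Phi> \<omega>} \<in> sets (signs p q)"
  shows "(AE \<xi> in coins p. cut \<xi> 0 \<longrightarrow> (AE \<eta> in coins q. \<Phi> (\<xi>, \<eta>)))
    \<or> (AE \<xi> in coins p. cut \<xi> 0 \<longrightarrow> (AE \<eta> in coins q. \<not> \<Phi> (\<xi>, \<eta>)))"
proof (rule ccontr)
  assume neg: "\<not> ?thesis"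
  have p: "1 / 2 < p" "p \<le> 1" using pq by simp_all
  define E where "E = {\<xi>. cut \<xi> 0} \<inter> {\<xi>. AE \<eta> in coins q. \<not> \<Phi> (\<xi>, \<eta>)}"
  have E: "E \<in> sets (coins p)"
    unfolding E_def by (intro sets.Int sets_AE_fibre[OF meas] sets_coins_Collect pred_cut)
  have "measure (coins p) E > 0"
  proof (rule ccontr)
    assume "\<not> measure (coins p) E > 0"
    then have "measure (coins p) E = 0" by (simp add: zero_less_measure_iff)
    then have "AE \<xi> in coins p. \<xi> \<notin> E" using E by (simp add: coins.prob_eq_0)
    with fibre_zero_one[OF pq inv meas]
    have "AE \<xi> in coins p. cut \<xi> 0 \<longrightarrow> (AE \<eta> in coins q. \<Phi> (\<xi>, \<eta>))"
      by eventually_elim (auto simp: E_def)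
    with neg show False by blast
  qed
  \<comment> \<open>Starting the progression at \<open>1\<close> puts the second cut strictly to the
    right, hence strictly higher.\<close>
  from AE_of_mixing[OF E this, of 1 1]
  have "AE \<xi> in coins p. \<exists>n :: nat. shift (1 + int n) \<xi> \<in> E" by simp
  with fibre_zero_one[OF pq inv meas] AE_drifting[OF p]
  have "AE \<xi> in coins p. cut \<xi> 0 \<longrightarrow> (AE \<eta> in coins q. \<not> \<Phi> (\<xi>, \<eta>))"
  proof eventually_elim
    case (elim \<xi>)
    show ?case
    proof (rule impI)
      assume c0: "cut \<xi> 0"
      obtain n :: nat where n: "shift (1 + int n) \<xi> \<in> E" using elim by blast
      define x where "x = 1 + int n"
      have cx: "cut \<xi> x" using n by (simp add: E_def cut_shift x_def)
      have "walk \<xi> 0 < walk \<xi> x" using c0 unfolding cut_def by (auto simp: x_def)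
      \<comment> \<open>If \<open>\<eta>\<close> is \<open>-1\<close> at
        \<open>0, ..., s - 1\<close>, its walk falls by the height gained between the cuts, so
        \<open>(0, 0)\<close> and \<open>(x, s)\<close> have the same level. Such runs have positive
        probability.\<close>
      then obtain s where s: "walk \<xi> x = int s" "s > 0"
        by (metis nonneg_int_cases of_nat_0_less_iff order_less_imp_le walk_0)
      have "\<not> (AE \<eta> in coins q. \<Phi> (\<xi>, \<eta>))"
      proof
        assume "AE \<eta> in coins q. \<Phi> (\<xi>, \<eta>)"
        moreover have "AE \<eta> in coins q. \<not> \<Phi> (shift x \<xi>, shift (int s) \<eta>)"
          unfolding shift_def[of "int s"]
          by (rule AE_coins_reindex[OF inj_add_int]) (use n in \<open>simp add: E_def x_def\<close>)
        ultimately have "AE \<eta> in coins q. \<eta> \<notin> {\<eta>. \<forall>i\<in>{0..<int s}. \<eta> i = -1}"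
          using AE_coins_pm[of q]
        proof eventually_elim
          case (elim \<eta>)
          show ?case
          proof
            assume "\<eta> \<in> {\<eta>. \<forall>i\<in>{0..<int s}. \<eta> i = -1}"
            then have "walk \<eta> (int s) = - int s" using walk_run[of s \<eta> 0 "-1"] by simp
            then have "\<Phi> (shift x \<xi>, shift (int s) \<eta>) = \<Phi> (shift 0 \<xi>, shift 0 \<eta>)"
              using path_invariant_cuts[OF inv \<open>drifting \<xi>\<close> \<open>pm \<eta>\<close> c0 cx, of 0 "int s"] s by simp
            with elim show False by simp
          qed
        qed
        moreover have "{\<eta>. \<forall>i\<in>{0..<int s}. \<eta> i = -1} \<in> sets (coins q)"
          by (rule sets_coins_Collect, intro pred_intros_finite, simp, rule pred_count_space[OF measurable_coord])
        ultimately have "measure (coins q) {\<eta>. \<forall>i\<in>{0..<int s}. \<eta> i = -1} = 0"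
          using coins.prob_eq_0 by blast
        then show False using measure_run_pos[OF pq(3,4), of "-1" s] by simp
      qed
      with elim c0 show "AE \<eta> in coins q. \<not> \<Phi> (\<xi>, \<eta>)" by blast
    qed
  qed
  with neg show False by blast
qed

definition aperiodic :: "(int \<Rightarrow> int) \<times> (int \<Rightarrow> int) \<Rightarrow> bool" where
  "aperiodic \<omega> \<longleftrightarrow> (\<forall>n>0. (step (fst \<omega>) (snd \<omega>) ^^ n) (0, 0) \<noteq> (0, 0))"

text \<open>The claim at cuts holds at all of the countably many translates simultaneously; an
  aperiodic path hits a cut vertex, and path invariance brings the value there back to the
  origin.\<close>

lemma AE_cuts_imp_AE_aperiodic:
  assumes pq: "1 / 2 < p" "p < 1" "0 < q" "q < 1"
    and inv: "path_invariant \<Phi>" and meas: "{\<omega>. \<Phi> \<omega>} \<in> sets (signs p q)"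
    and ae: "AE \<xi> in coins p. cut \<xi> 0 \<longrightarrow> (AE \<eta> in coins q. \<Phi> (\<xi>, \<eta>))"
  shows "AE \<omega> in signs p q.
    aperiodic \<omega> \<longrightarrow> \<Phi> \<omega>"
proof -
  have "AE \<omega> in signs p q. cut (fst \<omega>) 0 \<longrightarrow> \<Phi> \<omega>"
    unfolding signs_def
  proof (rule signs_pair.AE_pair_measure)
    have "{\<omega> \<in> space (coins p \<Otimes>\<^sub>M coins q). cut (fst \<omega>) 0 \<longrightarrow> \<Phi> \<omega>} = (UNIV - {\<omega>. cut (fst \<omega>) 0}) \<union> {\<omega>. \<Phi> \<omega>}"
      by (auto simp: space_pair_measure)
    also have "\<dots> \<in> sets (signs p q)" by (intro sets.Un sets.Diff meas sets_cut) simp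
    finally show "{\<omega> \<in> space (coins p \<Otimes>\<^sub>M coins q). cut (fst \<omega>) 0 \<longrightarrow> \<Phi> \<omega>} \<in> sets (coins p \<Otimes>\<^sub>M coins q)"
      by (simp add: signs_def)
    show "AE \<xi> in coins p. AE \<eta> in coins q. cut (fst (\<xi>, \<eta>)) 0 \<longrightarrow> \<Phi> (\<xi>, \<eta>)"
      using ae by eventually_elim (auto elim: eventually_mono)
  qed
  from AE_reindex2[OF inj_add_int inj_add_int this]
  have "AE \<omega> in signs p q. cut (fst (shift2 x y \<omega>)) 0 \<longrightarrow> \<Phi> (shift2 x y \<omega>)" for x y
    unfolding shift2_def .
  then have "AE \<omega> in signs p q. \<forall>x y. cut (fst (shift2 x y \<omega>)) 0 \<longrightarrow> \<Phi> (shift2 x y \<omega>)"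
    by (simp only: AE_all_countable) blast
  with AE_typical[OF pq] AE_signs_fst[OF AE_coins_pm[of p], of q] show ?thesis
  proof eventually_elim
    case (elim \<omega>)
    show ?case
    proof
      assume "aperiodic \<omega>"
      then obtain n x y where n: "(step (fst \<omega>) (snd \<omega>) ^^ n) (0, 0) = (x, y)" "cut (fst \<omega>) x"
        using orbit_hits_cut[OF elim(1), of "(0, 0)"] unfolding aperiodic_def by blast
      have "pm (snd \<omega>)" using elim by (simp add: typical_def)
      from path_invariant_orbit[OF inv elim(2) this n(1)]
      have "\<Phi> (shift2 x y \<omega>) = \<Phi> \<omega>" by (simp add: shift2_eq)
      then show "\<Phi> \<omega>" using elim(3) n(2) by (auto simp: shift2_eq cut_shift)
    qed
  qed
qed

lemma aperiodic_zero_one: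
  assumes pq: "1 / 2 < p" "p < 1" "0 < q" "q < 1"
    and inv: "path_invariant \<Phi>" and meas: "{\<omega>. \<Phi> \<omega>} \<in> sets (signs p q)"
  shows "(AE \<omega> in signs p q. aperiodic \<omega> \<longrightarrow> \<Phi> \<omega>)
    \<or> (AE \<omega> in signs p q. aperiodic \<omega> \<longrightarrow> \<not> \<Phi> \<omega>)"
proof -
  have "{\<omega>. \<not> \<Phi> \<omega>} = UNIV - {\<omega>. \<Phi> \<omega>}" by auto
  then have "{\<omega>. \<not> \<Phi> \<omega>} \<in> sets (signs p q)" using meas sets.Diff[OF UNIV_signs meas] by simp
  with cut_zero_one[OF pq inv meas] AE_cuts_imp_AE_aperiodic[OF pq inv meas]
    AE_cuts_imp_AE_aperiodic[OF pq path_invariant_not[OF inv]]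
  show ?thesis by blast
qed

section \<open>Reduction to positive drift\<close>

lemma coin_eqI:
  assumes N: "prob_space N" "sets N = UNIV" and r: "0 \<le> r" "r \<le> 1"
    and m: "measure N {1} = r" "measure N {-1} = 1 - r"
  shows "N = coin r"
proof (rule measure_eqI_countable[where A = UNIV])
  fix a :: int
  have *: "emeasure L {a} = ennreal (if a = 1 then r else if a = -1 then 1 - r else 0)"
    if L: "prob_space L" "sets L = UNIV" "measure L {1} = r" "measure L {-1} = 1 - r" for L
  proof -
    interpret prob_space L by fact
    have "measure L {a} = 0" if "a \<noteq> 1" "a \<noteq> -1"
    proof -
      have "measure L {a, 1, -1} = measure L {a} + measure L {1} + measure L {-1}"
        using that finite_measure_Union[of "{a}" "{1, -1}"] finite_measure_Union[of "{1}" "{-1}"] L(2)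
        by (simp add: insert_commute)
      then show ?thesis using L(3,4) prob_le_1[of "{a, 1, -1}"] measure_nonneg[of L "{a}"] by linarith
    qed
    then show ?thesis using L(3,4) by (auto simp: emeasure_eq_measure)
  qed
  show "emeasure N {a} = emeasure (coin r) {a}"
    using *[OF N m] *[OF prob_space_coin sets_coin measure_coin_1[OF r] measure_coin_m1[OF r]] by simp
qed (use N in simp_all)

lemma (in prob_space) indep_signs_law:
  assumes ind: "indep_vars (\<lambda>_. count_space UNIV) X UNIV" and r: "0 \<le> r" "r \<le> 1"
    and m: "\<And>k. prob {s \<in> space M. X k s = 1} = r" "\<And>k. prob {s \<in> space M. X k s = -1} = 1 - r"
  shows "(\<lambda>s k. X k s) \<in> M \<rightarrow>\<^sub>M coins r" "distr M (coins r) (\<lambda>s k. X k s) = coins r"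
proof -
  have rv: "X k \<in> M \<rightarrow>\<^sub>M count_space UNIV" for k using ind by (simp add: indep_vars_def)
  show "(\<lambda>s k. X k s) \<in> M \<rightarrow>\<^sub>M coins r" by (rule measurable_coinsI) (rule rv)
  have c: "distr M (count_space UNIV) (X k) = coin r" for k
  proof (rule coin_eqI[OF prob_space_distr[OF rv] _ r])
    show "measure (distr M (count_space UNIV) (X k)) {1} = r"
      using m(1)[of k] by (subst measure_distr[OF rv]) (simp_all add: vimage_def Int_def conj_commute)
    show "measure (distr M (count_space UNIV) (X k)) {-1} = 1 - r"
      using m(2)[of k] by (subst measure_distr[OF rv]) (simp_all add: vimage_def Int_def conj_commute)
  qed simp
  have "distr M (\<Pi>\<^sub>M i\<in>UNIV. count_space UNIV) (\<lambda>x. \<lambda>i\<in>UNIV. X i x) = (\<Pi>\<^sub>M i\<in>UNIV. distr M (count_space UNIV) (X i))"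
    using ind by (subst (asm) indep_vars_iff_distr_eq_PiM) (simp_all add: rv)
  then have "distr M (\<Pi>\<^sub>M i\<in>UNIV. count_space UNIV) (\<lambda>x i. X i x) = coins r"
    unfolding c by (simp add: coins_def restrict_UNIV)
  moreover have "distr M (coins r) (\<lambda>s k. X k s) = distr M (\<Pi>\<^sub>M i\<in>UNIV. count_space UNIV) (\<lambda>x i. X i x)"
    by (rule distr_cong) (simp_all add: sets_coins)
  ultimately show "distr M (coins r) (\<lambda>s k. X k s) = coins r" by simp
qed

lemma (in corner_percolation) signs_law:
  assumes "0 \<le> p" "p \<le> 1" "0 \<le> q" "q \<le> 1"
  shows "(\<lambda>s. (\<lambda>k. \<xi> k s, \<lambda>k. \<eta> k s)) \<in> M \<rightarrow>\<^sub>M signs p q"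
    and "distr M (signs p q) (\<lambda>s. (\<lambda>k. \<xi> k s, \<lambda>k. \<eta> k s)) = signs p q"
proof -
  note lx = indep_signs_law[OF indep_xi assms(1,2) prob_xi]
  note le = indep_signs_law[OF indep_eta assms(3,4) prob_eta]
  show "(\<lambda>s. (\<lambda>k. \<xi> k s, \<lambda>k. \<eta> k s)) \<in> M \<rightarrow>\<^sub>M signs p q"
    unfolding signs_def by (rule measurable_Pair[OF lx(1) le(1)])
  let ?S = "\<Pi>\<^sub>M k\<in>(UNIV :: int set). count_space (UNIV :: int set)"
  have d: "distr M ?S (\<lambda>s k. X k s) = distr M (coins r) (\<lambda>s k. X k s)" for X r
    by (rule distr_cong) (simp_all add: sets_coins)
  have "distr M ?S (\<lambda>s k. \<xi> k s) \<Otimes>\<^sub>M distr M ?S (\<lambda>s k. \<eta> k s)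
      = distr M (?S \<Otimes>\<^sub>M ?S) (\<lambda>s. (\<lambda>k. \<xi> k s, \<lambda>k. \<eta> k s))"
    using indep_xi_eta unfolding indep_var_distribution_eq by blast
  also have "\<dots> = distr M (signs p q) (\<lambda>s. (\<lambda>k. \<xi> k s, \<lambda>k. \<eta> k s))"
    unfolding signs_def by (intro distr_cong sets_pair_measure_cong) (simp_all add: sets_coins)
  finally show "distr M (signs p q) (\<lambda>s. (\<lambda>k. \<xi> k s, \<lambda>k. \<eta> k s)) = signs p q"
    unfolding d[of \<xi> p] d[of \<eta> q] lx(2) le(2) by (simp add: signs_def)
qed

text \<open>The reflection of the plane that sends \<open>y\<close> to \<open>- y\<close>: vertical
  steps change sign, which replaces \<open>p\<close> by \<open>1 - p\<close>, and the rows are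
  reversed.\<close>

definition reflect :: "(int \<Rightarrow> int) \<times> (int \<Rightarrow> int) \<Rightarrow> (int \<Rightarrow> int) \<times> (int \<Rightarrow> int)" where
  "reflect \<omega> = (\<lambda>k. - fst \<omega> k, \<lambda>k. snd \<omega> (- k))"

lemma reflect_reflect [simp]: "reflect (reflect \<omega>) = \<omega>"
  by (simp add: reflect_def)

lemma negate_law:
  assumes "0 \<le> p" "p \<le> 1"
  shows "(\<lambda>\<xi> k. - \<xi> k) \<in> coins p \<rightarrow>\<^sub>M coins (1 - p)"
    and "distr (coins p) (coins (1 - p)) (\<lambda>\<xi> k. - \<xi> k) = coins (1 - p)"
proof -
  have "coins.indep_vars p (\<lambda>_. count_space UNIV) (\<lambda>k \<xi>. - \<xi> k) UNIV"
    by (rule coins.indep_vars_compose2[OF indep_coords]) (simp add: coin_def)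
  moreover have "{\<xi> \<in> space (coins p). - \<xi> k = 1} = {\<xi>. \<xi> k = -1}"
    "{\<xi> \<in> space (coins p). - \<xi> k = -1} = {\<xi>. \<xi> k = 1}" for k :: int by auto
  ultimately show "(\<lambda>\<xi> k. - \<xi> k) \<in> coins p \<rightarrow>\<^sub>M coins (1 - p)"
    "distr (coins p) (coins (1 - p)) (\<lambda>\<xi> k. - \<xi> k) = coins (1 - p)"
    using coins.indep_signs_law[of p "\<lambda>k \<xi>. - \<xi> k" "1 - p"] measure_coord[OF assms] assms by simp_all
qed

lemma reflect_law:
  assumes "0 \<le> p" "p \<le> 1"
  shows "reflect \<in> signs p q \<rightarrow>\<^sub>M signs (1 - p) q"
    and "distr (signs p q) (signs (1 - p) q) reflect = signs (1 - p) q"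
proof -
  have r: "reflect = (\<lambda>(x, y). (\<lambda>k. - x k, \<lambda>k. y (- k)))" by (auto simp: reflect_def)
  have i: "inj (\<lambda>k :: int. - k)" by (simp add: inj_def)
  have "(\<lambda>\<omega>. (\<lambda>\<xi> k. - \<xi> k) (fst \<omega>)) \<in> signs p q \<rightarrow>\<^sub>M coins (1 - p)"
    by (rule measurable_compose[OF measurable_fst_signs negate_law(1)[OF assms]])
  moreover have "(\<lambda>\<omega>. (\<lambda>\<xi> k. \<xi> (- k)) (snd \<omega>)) \<in> signs p q \<rightarrow>\<^sub>M coins q"
    by (rule measurable_compose[OF measurable_snd_signs measurable_reindex])
  ultimately show "reflect \<in> signs p q \<rightarrow>\<^sub>M signs (1 - p) q"
    unfolding reflect_def[abs_def] by (subst (2) signs_def) (rule measurable_Pair)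
  have "distr (coins p) (coins (1 - p)) (\<lambda>\<xi> k. - \<xi> k) \<Otimes>\<^sub>M distr (coins q) (coins q) (\<lambda>\<xi> k. \<xi> (- k))
      = distr (coins p \<Otimes>\<^sub>M coins q) (coins (1 - p) \<Otimes>\<^sub>M coins q) (\<lambda>(x, y). (\<lambda>k. - x k, \<lambda>k. y (- k)))"
    by (rule pair_measure_distr[OF negate_law(1)[OF assms] measurable_reindex])
      (simp add: distr_coins_reindex i prob_space_imp_sigma_finite)
  then show "distr (signs p q) (signs (1 - p) q) reflect = signs (1 - p) q"
    unfolding signs_def r negate_law(2)[OF assms] distr_coins_reindex[OF i] by metis
qed

lemma swap_law:
  shows "prod.swap \<in> signs p q \<rightarrow>\<^sub>M signs q p"
    and "distr (signs p q) (signs q p) prod.swap = signs q p"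
proof -
  have s: "prod.swap = (\<lambda>(x, y). (y, x))" by auto
  show "prod.swap \<in> signs p q \<rightarrow>\<^sub>M signs q p"
    unfolding signs_def s by (rule measurable_pair_swap')
  show "distr (signs p q) (signs q p) prod.swap = signs q p"
    unfolding signs_def s by (rule signs_pair.distr_pair_swap[symmetric])
qed

lemma step_reflect:
  "step (fst (reflect \<omega>)) (snd (reflect \<omega>)) (x, y) = apsnd uminus (step (fst \<omega>) (snd \<omega>) (x, - y))"
  by (simp add: step_def reflect_def)

lemma aperiodic_reflect:
  assumes "aperiodic \<omega>"
  shows "aperiodic (reflect \<omega>)"
proof -
  have "(step (fst (reflect \<omega>)) (snd (reflect \<omega>)) ^^ n) (0, 0) = apsnd uminus ((step (fst \<omega>) (snd \<omega>) ^^ n) (0, 0))" for n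
  proof (induction n)
    case (Suc n)
    obtain x y where "(step (fst \<omega>) (snd \<omega>) ^^ n) (0, 0) = (x, y)" by fastforce
    with Suc show ?case using step_reflect[of \<omega> x "- y"] by simp
  qed simp
  moreover have "v = (0, 0)" if "apsnd uminus v = (0, 0)" for v :: vertex
    using that by (cases v) simp
  ultimately show ?thesis using assms unfolding aperiodic_def by metis
qed

lemma path_invariant_reflect:
  assumes "path_invariant \<Phi>"
  shows "path_invariant (\<lambda>\<omega>. \<Phi> (reflect \<omega>))"
  unfolding path_invariant_def
proof (intro allI impI)
  fix \<xi> \<eta> a b assume pm: "pm \<xi>" "pm \<eta>" and st: "step \<xi> \<eta> (0, 0) = (a, b)"
  have pm': "pm (\<lambda>k. - \<xi> k)" "pm (\<lambda>k. \<eta> (- k))" using pm by (auto simp: pm_def)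
  have "step (\<lambda>k. - \<xi> k) (\<lambda>k. \<eta> (- k)) (0, 0) = (a, - b)"
    using step_reflect[of "(\<xi>, \<eta>)" 0 0] st by (simp add: reflect_def)
  with assms pm' have "\<Phi> (shift a (\<lambda>k. - \<xi> k), shift (- b) (\<lambda>k. \<eta> (- k))) = \<Phi> (\<lambda>k. - \<xi> k, \<lambda>k. \<eta> (- k))"
    unfolding path_invariant_def by blast
  then show "\<Phi> (reflect (shift a \<xi>, shift b \<eta>)) = \<Phi> (reflect (\<xi>, \<eta>))"
    by (simp add: reflect_def shift_def)
qed

text \<open>Exchanging the axes reverses the orientation of the path: a step then begins with what
  was the vertical edge.\<close>

lemma step_swap: "step \<eta> \<xi> (prod.swap v) = prod.swap (unstep \<xi> \<eta> v)"
  by (cases v) (simp add: step_def unstep_def)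

lemma aperiodic_swap:
  assumes "aperiodic \<omega>"
  shows "aperiodic (prod.swap \<omega>)"
  unfolding aperiodic_def
proof (intro allI impI notI)
  fix n :: nat assume n: "n > 0" "(step (fst (prod.swap \<omega>)) (snd (prod.swap \<omega>)) ^^ n) (0, 0) = (0, 0)"
  let ?s = "step (fst \<omega>) (snd \<omega>)" and ?u = "unstep (fst \<omega>) (snd \<omega>)"
  have "(step (snd \<omega>) (fst \<omega>) ^^ m) (0, 0) = prod.swap ((?u ^^ m) (0, 0))" for m
    by (induction m) (simp_all add: step_swap)
  with n have "(?u ^^ n) (0, 0) = (0, 0)" by (metis fst_swap snd_swap swap_simp swap_swap)
  moreover have "(?s ^^ m) ((?u ^^ m) v) = v" for m v
    by (induction m arbitrary: v) (simp_all add: funpow_swap1)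
  ultimately have "(?s ^^ n) (0, 0) = (0, 0)" by metis
  with assms n(1) show False by (simp add: aperiodic_def)
qed

lemma path_invariant_swap:
  assumes "path_invariant \<Phi>"
  shows "path_invariant (\<lambda>\<omega>. \<Phi> (prod.swap \<omega>))"
  unfolding path_invariant_def
proof (intro allI impI)
  fix \<xi> \<eta> a b assume pm: "pm \<xi>" "pm \<eta>" and st: "step \<xi> \<eta> (0, 0) = (a, b)"
  have "unstep \<eta> \<xi> (0, 0) = (b, a)" using step_swap[of \<xi> \<eta> "(0, 0)"] st by (metis swap_simp swap_swap)
  then have "step \<eta> \<xi> (b, a) = (0, 0)" by (metis step_unstep)
  from path_invariant_step[OF assms pm(2,1) this]
  show "\<Phi> (prod.swap (shift a \<xi>, shift b \<eta>)) = \<Phi> (prod.swap (\<xi>, \<eta>))" by simp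
qed

section \<open>Transfer of the zero-one law by symmetries\<close>

definition zero_one :: "real \<Rightarrow> real \<Rightarrow> bool" where
  "zero_one p q \<longleftrightarrow> (\<forall>\<Phi>. path_invariant \<Phi> \<longrightarrow> {\<omega>. \<Phi> \<omega>} \<in> sets (signs p q) \<longrightarrow>
     (AE \<omega> in signs p q. aperiodic \<omega> \<longrightarrow> \<Phi> \<omega>) \<or> (AE \<omega> in signs p q. aperiodic \<omega> \<longrightarrow> \<not> \<Phi> \<omega>))"

lemma zero_one_transfer:
  assumes zo: "zero_one p q" and f: "f \<in> signs p' q' \<rightarrow>\<^sub>M signs p q" "distr (signs p' q') (signs p q) f = signs p q"
    and g: "f \<in> signs p q \<rightarrow>\<^sub>M signs p' q'"
    and inv: "\<And>\<omega>. f (f \<omega>) = \<omega>" and pi: "\<And>\<Phi>. path_invariant \<Phi> \<Longrightarrow> path_invariant (\<lambda>\<omega>. \<Phi> (f \<omega>))"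
    and ap: "\<And>\<omega>. aperiodic \<omega> \<Longrightarrow> aperiodic (f \<omega>)"
  shows "zero_one p' q'"
  unfolding zero_one_def
proof (intro allI impI)
  fix \<Phi> assume \<Phi>: "path_invariant \<Phi>" "{\<omega>. \<Phi> \<omega>} \<in> sets (signs p' q')"
  have "{\<omega>. \<Phi> (f \<omega>)} \<in> sets (signs p q)"
    using measurable_sets[OF g \<Phi>(2)] by (simp add: vimage_def)
  with zo pi[OF \<Phi>(1)] have
    "(AE \<omega> in signs p q. aperiodic \<omega> \<longrightarrow> \<Phi> (f \<omega>)) \<or> (AE \<omega> in signs p q. aperiodic \<omega> \<longrightarrow> \<not> \<Phi> (f \<omega>))"
    unfolding zero_one_def by blast
  moreover have "AE \<omega> in signs p' q'. P (f \<omega>)" if "AE \<omega> in signs p q. P \<omega>" for P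
    by (rule AE_distrD[OF f(1)]) (use that f(2) in \<open>simp only:\<close>)
  ultimately consider "AE \<omega> in signs p' q'. aperiodic (f \<omega>) \<longrightarrow> \<Phi> (f (f \<omega>))"
    | "AE \<omega> in signs p' q'. aperiodic (f \<omega>) \<longrightarrow> \<not> \<Phi> (f (f \<omega>))"
    by blast
  then show "(AE \<omega> in signs p' q'. aperiodic \<omega> \<longrightarrow> \<Phi> \<omega>) \<or> (AE \<omega> in signs p' q'. aperiodic \<omega> \<longrightarrow> \<not> \<Phi> \<omega>)"
  proof cases
    case 1
    then have "AE \<omega> in signs p' q'. aperiodic \<omega> \<longrightarrow> \<Phi> \<omega>"
      by eventually_elim (simp add: inv ap)
    then show ?thesis ..
  next
    case 2
    then have "AE \<omega> in signs p' q'. aperiodic \<omega> \<longrightarrow> \<not> \<Phi> \<omega>"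
      by eventually_elim (simp add: inv ap)
    then show ?thesis ..
  qed
qed

lemma zero_one_biased:
  assumes "0 < p" "p < 1" "0 < q" "q < 1" "p \<noteq> 1 / 2"
  shows "zero_one p q"
proof (cases "p > 1 / 2")
  case True
  then show ?thesis
    using aperiodic_zero_one[of p q] assms unfolding zero_one_def by simp
next
  case False
  with assms have "zero_one (1 - p) q"
    using aperiodic_zero_one[of "1 - p" q] unfolding zero_one_def by simp
  then show ?thesis
    using reflect_law[of p q] reflect_law[of "1 - p" q] assms
    by (elim zero_one_transfer[where f = reflect]) (auto intro: path_invariant_reflect aperiodic_reflect)
qed

lemma zero_one_signs:
  assumes "0 < p" "p < 1" "0 < q" "q < 1" "(p, q) \<noteq> (1 / 2, 1 / 2)"
  shows "zero_one p q"
proof (cases "p = 1 / 2")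
  case True
  with assms have "zero_one q p" by (intro zero_one_biased) auto
  then show ?thesis
    using swap_law by (elim zero_one_transfer[where f = prod.swap]) (auto intro: path_invariant_swap aperiodic_swap)
next
  case False
  with assms show ?thesis by (intro zero_one_biased)
qed

section \<open>Clusters of corner percolation\<close>

lemma edge_in_lattice:
  "{(x, y), (a, b)} \<in> lattice_edges \<longleftrightarrow>
     a = x \<and> (b = y + 1 \<or> b = y - 1) \<or> b = y \<and> (a = x + 1 \<or> a = x - 1)"
proof
  show "{(x, y), (a, b)} \<in> lattice_edges"
    if "a = x \<and> (b = y + 1 \<or> b = y - 1) \<or> b = y \<and> (a = x + 1 \<or> a = x - 1)"
  proof -
    have "{(x', y'), (x', y' + 1)} \<in> lattice_edges" "{(x', y'), (x' + 1, y')} \<in> lattice_edges" for x' y'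
      unfolding lattice_edges_def by blast+
    from this[of x y] this(1)[of x "y - 1"] this(2)[of "x - 1" y] that
    show ?thesis by (auto simp: insert_commute)
  qed
qed (auto simp: lattice_edges_def doubleton_eq_iff)

lemma corner_config_vertical:
  "corner_config \<xi> \<eta> {(x, y), (x, y + 1)} \<longleftrightarrow> odd (x + y) \<and> \<xi> x = 1 \<or> even (x + y) \<and> \<xi> x = -1"
  using edge_in_lattice[of x y x "y + 1"] unfolding corner_config_def
  by (auto simp: doubleton_eq_iff)

lemma corner_config_horizontal:
  "corner_config \<xi> \<eta> {(x, y), (x + 1, y)} \<longleftrightarrow> odd (x + y) \<and> \<eta> y = 1 \<or> even (x + y) \<and> \<eta> y = -1"
  using edge_in_lattice[of x y "x + 1" y] unfolding corner_config_def
  by (auto simp: doubleton_eq_iff)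

lemma corner_config_in_space: "corner_config \<xi> \<eta> \<in> space config_space"
  by (simp add: config_space_def space_PiM corner_config_def)

text \<open>An even vertex is left horizontally and the odd vertex then reached vertically, so
  \<open>step\<close> is exactly two open edges; the other neighbour of an even vertex is the
  midpoint of the preceding step.\<close>

lemma open_adj_corner_config:
  assumes "pm \<xi>" "pm \<eta>"
  shows "((x, y), w) \<in> open_adj (corner_config \<xi> \<eta>) \<longleftrightarrow>
    (if even (x + y) then w \<in> {(x - \<eta> y, y), (x, y - \<xi> x)} else w \<in> {(x + \<eta> y, y), (x, y + \<xi> x)})"
proof -
  obtain a b where w: "w = (a, b)" by fastforce
  have sg: "\<xi> x = 1 \<or> \<xi> x = -1" "\<eta> y = 1 \<or> \<eta> y = -1" using assms by (auto simp: pm_def)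
  have flip: "{(x, y), (x, y - 1)} = {(x, y - 1), (x, y - 1 + 1)}" "{(x, y), (x - 1, y)} = {(x - 1, y), (x - 1 + 1, y)}"
    by auto
  have c: "corner_config \<xi> \<eta> {(x, y), (x, y - 1)} \<longleftrightarrow> even (x + y) \<and> \<xi> x = 1 \<or> odd (x + y) \<and> \<xi> x = -1"
    "corner_config \<xi> \<eta> {(x, y), (x - 1, y)} \<longleftrightarrow> even (x + y) \<and> \<eta> y = 1 \<or> odd (x + y) \<and> \<eta> y = -1"
    unfolding flip corner_config_vertical corner_config_horizontal by auto
  show ?thesis
    using sg unfolding open_adj_def w mem_Collect_eq case_prod_conv edge_in_lattice
    by (auto simp: c corner_config_vertical corner_config_horizontal)
qed

text \<open>The rule for open edges depends on parity, so only even translations act as shifts of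
  the signs. Displacements of \<open>step\<close> are even, as both coordinates change by
  one.\<close>

lemma translate_corner_config:
  assumes "even (a + b)"
  shows "translate (- a, - b) (corner_config \<xi> \<eta>) = corner_config (shift a \<xi>) (shift b \<eta>)"
proof
  fix e
  show "translate (- a, - b) (corner_config \<xi> \<eta>) e = corner_config (shift a \<xi>) (shift b \<eta>) e"
  proof (cases "e \<in> lattice_edges")
    case False
    then show ?thesis by (simp add: translate_def corner_config_def)
  next
    case True
    then consider x y where "e = {(x, y), (x, y + 1)}" | x y where "e = {(x, y), (x + 1, y)}"
      unfolding lattice_edges_def by blast
    then show ?thesis
    proof cases
      case 1
      have "(\<lambda>v. v - (- a, - b)) ` e = {(x + a, y + b), (x + a, y + b + 1)}"
        unfolding 1 by (simp add: add.commute add.left_commute)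
      then have "translate (- a, - b) (corner_config \<xi> \<eta>) e
          = corner_config \<xi> \<eta> {(x + a, y + b), (x + a, y + b + 1)}"
        using True by (simp add: translate_def)
      moreover have par: "even (x + a + (y + b)) \<longleftrightarrow> even (x + y)" using assms by auto
      ultimately show ?thesis unfolding 1 corner_config_vertical par by (simp only: shift_def)
    next
      case 2
      have "(\<lambda>v. v - (- a, - b)) ` e = {(x + a, y + b), (x + a + 1, y + b)}"
        unfolding 2 by (simp add: add.commute add.left_commute)
      then have "translate (- a, - b) (corner_config \<xi> \<eta>) e
          = corner_config \<xi> \<eta> {(x + a, y + b), (x + a + 1, y + b)}"
        using True by (simp add: translate_def)
      moreover have par: "even (x + a + (y + b)) \<longleftrightarrow> even (x + y)" using assms by auto
      ultimately show ?thesis unfolding 2 corner_config_horizontal par by (simp only: shift_def)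
    qed
  qed
qed

lemma component_property_path_invariant:
  assumes "component_property A"
  shows "path_invariant (\<lambda>\<omega>. (corner_config (fst \<omega>) (snd \<omega>), (0, 0)) \<in> A)"
  unfolding path_invariant_def
proof (intro allI impI)
  fix \<xi> \<eta> a b assume pm: "pm \<xi>" "pm \<eta>" and st: "step \<xi> \<eta> (0, 0) = (a, b)"
  let ?c = "corner_config \<xi> \<eta>"
  have ab: "a = - \<eta> 0" "b = \<xi> a" using st by (auto simp: step_def)
  have odd: "odd (\<xi> k)" "odd (\<eta> k)" for k
    using pm by (auto simp: pm_def) (metis even_minus odd_one)+
  have "((0, 0), (a, 0)) \<in> open_adj ?c" "((a, 0), (a, b)) \<in> open_adj ?c"
    using odd by (simp_all add: open_adj_corner_config[OF pm] ab)
  then have "(a, b) \<in> cluster ?c (0, 0)"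
    unfolding cluster_def mem_Collect_eq by (rule rtrancl_into_rtrancl[OF r_into_rtrancl])
  then have "(?c, (0, 0)) \<in> A \<longleftrightarrow> (?c, (a, b)) \<in> A"
    using assms corner_config_in_space unfolding component_property_def by blast
  also have "\<dots> \<longleftrightarrow> (translate (- a, - b) ?c, (a, b) + (- a, - b)) \<in> A"
    using assms corner_config_in_space unfolding component_property_def by blast
  also have "\<dots> \<longleftrightarrow> (corner_config (shift a \<xi>) (shift b \<eta>), (0, 0)) \<in> A"
    using translate_corner_config[of a b \<xi> \<eta>] odd ab by simp
  finally show "((corner_config (fst (shift a \<xi>, shift b \<eta>)) (snd (shift a \<xi>, shift b \<eta>)), (0, 0)) \<in> A) =
       ((corner_config (fst (\<xi>, \<eta>)) (snd (\<xi>, \<eta>)), (0, 0)) \<in> A)" by simp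
qed

text \<open>A closed path has finitely many even vertices; with the odd vertices between them they
  form a set closed under open edges, which contains the whole cluster.\<close>

lemma infinite_cluster_aperiodic:
  assumes pm: "pm \<xi>" "pm \<eta>" and inf: "infinite (cluster (corner_config \<xi> \<eta>) (0, 0))"
  shows "aperiodic (\<xi>, \<eta>)"
  unfolding aperiodic_def
proof (intro allI impI notI)
  let ?s = "step \<xi> \<eta>" and ?c = "corner_config \<xi> \<eta>"
  fix n :: nat assume n: "n > 0" "(step (fst (\<xi>, \<eta>)) (snd (\<xi>, \<eta>)) ^^ n) (0, 0) = (0, 0)"
  \<comment> \<open>The odd vertex passed between \<open>v\<close> and
    \<open>step \<xi> \<eta> v\<close>.\<close>
  define mid where "mid = (\<lambda>(x, y). (x - \<eta> y, y :: int))"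
  define Z where "Z = range (\<lambda>k. (?s ^^ k) (0, 0))"
  have odd: "odd (\<xi> k)" "odd (\<eta> k)" for k
    using pm by (auto simp: pm_def) (metis even_minus odd_one)+
  have per: "(?s ^^ (k mod n)) (0, 0) = (?s ^^ k) (0, 0)" for k
    using n(2) by (intro funpow_mod_eq) simp
  have Z_eq: "Z = (\<lambda>k. (?s ^^ k) (0, 0)) ` {..<n}"
  proof
    show "Z \<subseteq> (\<lambda>k. (?s ^^ k) (0, 0)) ` {..<n}"
      unfolding Z_def using per n(1) by (metis (no_types, lifting) image_eqI image_subsetI lessThan_iff mod_less_divisor)
  qed (auto simp: Z_def)
  then have fin: "finite (Z \<union> mid ` Z)" by simp
  have fwd: "?s v \<in> Z" if vZ: "v \<in> Z" for v
  proof -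
    obtain k where "v = (?s ^^ k) (0, 0)" using vZ unfolding Z_def by blast
    then have "?s v = (?s ^^ Suc k) (0, 0)" by simp
    then show ?thesis unfolding Z_def by blast
  qed
  have bwd: "unstep \<xi> \<eta> v \<in> Z" if vZ: "v \<in> Z" for v
  proof -
    obtain k where k: "v = (?s ^^ k) (0, 0)" using vZ unfolding Z_def by blast
    \<comment> \<open>Periodicity supplies a predecessor even for the origin, at time
      \<open>n - 1\<close>.\<close>
    have "\<exists>m. (?s ^^ k) (0, 0) = (?s ^^ Suc m) (0, 0)"
    proof (cases k)
      case 0
      then show ?thesis using n by (intro exI[of _ "n - 1"]) simp
    next
      case (Suc m)
      then show ?thesis by (intro exI[of _ m]) simp
    qed
    then obtain m where "(?s ^^ k) (0, 0) = (?s ^^ Suc m) (0, 0)" by blast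
    with k have "unstep \<xi> \<eta> v = (?s ^^ m) (0, 0)" by simp
    then show ?thesis unfolding Z_def by blast
  qed
  have even_Z: "even (fst v + snd v)" if "v \<in> Z" for v
  proof -
    have "even (fst ((?s ^^ k) (0, 0)) + snd ((?s ^^ k) (0, 0)))" for k
    proof (induction k)
      case (Suc k)
      obtain x y where "(?s ^^ k) (0, 0) = (x, y)" by fastforce
      with Suc odd show ?case by (simp add: step_def)
    qed simp
    with that show ?thesis unfolding Z_def by blast
  qed
  have closed: "w \<in> Z \<union> mid ` Z" if "v \<in> Z \<union> mid ` Z" "(v, w) \<in> open_adj ?c" for v w
    using that(1)
  proof
    assume v: "v \<in> Z"
    obtain x y where xy: "v = (x, y)" by fastforce
    have "w = mid v \<or> w = mid (unstep \<xi> \<eta> v)"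
      using that(2) even_Z[OF v] by (auto simp: xy open_adj_corner_config[OF pm] mid_def unstep_def)
    then show ?thesis using v bwd[OF v] by blast
  next
    assume "v \<in> mid ` Z"
    then obtain x y where xy: "(x, y) \<in> Z" "v = (x - \<eta> y, y)" by (auto simp: mid_def)
    have "odd (x - \<eta> y + y)" using even_Z[OF xy(1)] odd(2)[of y] by simp
    then have "w = (x, y) \<or> w = ?s (x, y)"
      using that(2) by (auto simp: xy(2) open_adj_corner_config[OF pm] step_def)
    then show ?thesis using xy(1) fwd[OF xy(1)] by blast
  qed
  have "cluster ?c (0, 0) \<subseteq> Z \<union> mid ` Z"
  proof
    fix w assume "w \<in> cluster ?c (0, 0)"
    then have "((0, 0), w) \<in> (open_adj ?c)\<^sup>*" by (simp add: cluster_def)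
    then show "w \<in> Z \<union> mid ` Z"
    proof (induction rule: rtrancl_induct)
      case base
      have "(?s ^^ 0) (0, 0) \<in> Z" unfolding Z_def by blast
      then show ?case by simp
    next
      case (step v w)
      then show ?case using closed by blast
    qed
  qed
  with fin inf show False using finite_subset by blast
qed

section \<open>Measurability of cluster events and conclusion\<close>

lemma measurable_corner_config:
  assumes f: "\<And>k. (\<lambda>s. f s k) \<in> M \<rightarrow>\<^sub>M count_space UNIV" and g: "\<And>k. (\<lambda>s. g s k) \<in> M \<rightarrow>\<^sub>M count_space UNIV"
  shows "(\<lambda>s. corner_config (f s) (g s)) \<in> M \<rightarrow>\<^sub>M config_space"
  unfolding corner_config_def config_space_def
proof (rule measurable_restrict)
  fix e
  show "Measurable.pred M (\<lambda>s. (\<exists>x y. e = {(x, y), (x, y + 1)} \<and>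
        (odd (x + y) \<and> f s x = 1 \<or> even (x + y) \<and> f s x = -1)) \<or>
     (\<exists>x y. e = {(x, y), (x + 1, y)} \<and>
        (odd (x + y) \<and> g s y = 1 \<or> even (x + y) \<and> g s y = -1)))"
    by (intro pred_intros_logic pred_intros_countable pred_count_space[OF f, where P = "\<lambda>a. a = c" for c]
        pred_count_space[OF g, where P = "\<lambda>a. a = c" for c]) simp_all
qed

lemma pred_open_adj: "Measurable.pred config_space (\<lambda>\<omega>. (u, v) \<in> open_adj \<omega>)"
proof (cases "{u, v} \<in> lattice_edges")
  case True
  have "(\<lambda>\<omega>. \<omega> {u, v}) \<in> config_space \<rightarrow>\<^sub>M count_space UNIV"
    unfolding config_space_def by (rule measurable_component_singleton[OF True])
  with True show ?thesis by (simp add: open_adj_def)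
qed (simp add: open_adj_def)

lemma pred_cluster: "Measurable.pred config_space (\<lambda>\<omega>. w \<in> cluster \<omega> v)"
proof -
  have "Measurable.pred config_space (\<lambda>\<omega>. (v, w) \<in> open_adj \<omega> ^^ n)" for n
  proof (induction n arbitrary: w)
    case (Suc n)
    have "Measurable.pred config_space (\<lambda>\<omega>. \<exists>u. (v, u) \<in> open_adj \<omega> ^^ n \<and> (u, w) \<in> open_adj \<omega>)"
      by (intro pred_intros_countable pred_intros_logic Suc pred_open_adj)
    moreover have "(\<lambda>\<omega>. (v, w) \<in> open_adj \<omega> ^^ Suc n) = (\<lambda>\<omega>. \<exists>u. (v, u) \<in> open_adj \<omega> ^^ n \<and> (u, w) \<in> open_adj \<omega>)"
      by (auto simp: fun_eq_iff)
    ultimately show ?case by simp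
  qed simp
  then have "Measurable.pred config_space (\<lambda>\<omega>. \<exists>n. (v, w) \<in> open_adj \<omega> ^^ n)"
    by (rule pred_intros_countable)
  then show ?thesis by (simp add: cluster_def rtrancl_power)
qed

text \<open>Coding vertices by naturals replaces infinitude by unboundedness, which involves only
  countable quantifiers.\<close>

lemma pred_infinite_cluster: "Measurable.pred config_space (\<lambda>\<omega>. infinite (cluster \<omega> v))"
proof -
  have "infinite (cluster \<omega> v) \<longleftrightarrow> (\<forall>n. \<exists>w. w \<in> cluster \<omega> v \<and> n < to_nat w)" for \<omega>
  proof -
    have "finite (to_nat ` cluster \<omega> v) \<longleftrightarrow> finite (cluster \<omega> v)"
      by (intro finite_image_iff) simp
    moreover have "infinite (to_nat ` cluster \<omega> v) \<longleftrightarrow> (\<forall>n. \<exists>w. w \<in> cluster \<omega> v \<and> n < to_nat w)"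
      unfolding infinite_nat_iff_unbounded by blast
    ultimately show ?thesis by blast
  qed
  moreover have "Measurable.pred config_space (\<lambda>\<omega>. \<forall>n. \<exists>w. w \<in> cluster \<omega> v \<and> n < to_nat w)"
    by (intro pred_intros_countable pred_intros_logic pred_cluster) simp
  ultimately show ?thesis by simp
qed

theorem theorem1p3:
  fixes M :: "'s measure" and p q :: real and \<xi> \<eta> :: "int \<Rightarrow> 's \<Rightarrow> int"
  assumes "0 < p" "p < 1" "0 < q" "q < 1"
    and "(p, q) \<noteq> (1 / 2, 1 / 2)"
    and "corner_percolation M p q \<xi> \<eta>"
  shows "indistinguishable_infinite_clusters M
           (\<lambda>s. corner_config (\<lambda>k. \<xi> k s) (\<lambda>k. \<eta> k s))"
  unfolding indistinguishable_infinite_clusters_def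
proof (intro allI impI)
  interpret corner_percolation M p q \<xi> \<eta> by fact
  fix A assume A: "component_property A"
  let ?X = "\<lambda>s. corner_config (\<lambda>k. \<xi> k s) (\<lambda>k. \<eta> k s)"
  let ?in = "\<lambda>s. (?X s, (0, 0)) \<in> A" and ?inf = "\<lambda>s. infinite (cluster (?X s) (0, 0))"
  define \<Phi> where "\<Phi> = (\<lambda>\<omega>. (corner_config (fst \<omega>) (snd \<omega>), (0, 0) :: vertex) \<in> A)"
  have A_sets: "A \<in> sets (config_space \<Otimes>\<^sub>M count_space UNIV)"
    using A by (simp add: component_property_def)
  have pair: "(\<lambda>x. (x, (0, 0))) \<in> config_space \<rightarrow>\<^sub>M config_space \<Otimes>\<^sub>M count_space UNIV"
    by (rule measurable_Pair) simp_all
  have "(\<lambda>\<omega>. corner_config (fst \<omega>) (snd \<omega>)) \<in> signs p q \<rightarrow>\<^sub>M config_space"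
    by (rule measurable_corner_config)
      (rule measurable_compose[OF measurable_fst_signs measurable_coord]
        measurable_compose[OF measurable_snd_signs measurable_coord])+
  from measurable_sets[OF measurable_compose[OF this pair] A_sets]
  have meas: "{\<omega>. \<Phi> \<omega>} \<in> sets (signs p q)" by (simp add: \<Phi>_def vimage_def)
  have "path_invariant \<Phi>" unfolding \<Phi>_def by (rule component_property_path_invariant[OF A])
  with zero_one_signs[OF assms(1-5)] meas
  have zo: "(AE \<omega> in signs p q. aperiodic \<omega> \<longrightarrow> \<Phi> \<omega>) \<or> (AE \<omega> in signs p q. aperiodic \<omega> \<longrightarrow> \<not> \<Phi> \<omega>)"
    unfolding zero_one_def by blast
  have pq: "0 \<le> p" "p \<le> 1" "0 \<le> q" "q \<le> 1" using assms by simp_all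
  note law = signs_law[OF pq]
  have AE_M: "AE s in M. P (\<lambda>k. \<xi> k s, \<lambda>k. \<eta> k s)" if "AE \<omega> in signs p q. P \<omega>" for P
    by (rule AE_distrD[OF law(1)]) (use that law(2) in \<open>simp only:\<close>)
  have pm: "AE s in M. pm (\<lambda>k. \<xi> k s)" "AE s in M. pm (\<lambda>k. \<eta> k s)"
    using AE_M[OF AE_signs_fst[OF AE_coins_pm]] AE_M[OF AE_signs_snd[OF AE_coins_pm]] by simp_all
  have rv: "\<xi> k \<in> M \<rightarrow>\<^sub>M count_space UNIV" "\<eta> k \<in> M \<rightarrow>\<^sub>M count_space UNIV" for k
    using indep_xi indep_eta by (simp_all add: indep_vars_def)
  have X: "?X \<in> M \<rightarrow>\<^sub>M config_space" by (rule measurable_corner_config) (rule rv)+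
  have sinf: "{s \<in> space M. ?inf s} \<in> events"
    by (rule predE) (rule measurable_compose[OF X pred_infinite_cluster])
  have "Measurable.pred M ?in"
    using measurable_sets[OF measurable_compose[OF X pair] A_sets]
    by (simp add: pred_def vimage_def Int_def conj_commute)
  then have sin: "{s \<in> space M. ?in s} \<in> events" by (rule predE)
  have "{s \<in> space M. ?in s \<and> ?inf s} = {s \<in> space M. ?in s} \<inter> {s \<in> space M. ?inf s}" by auto
  then have sboth: "{s \<in> space M. ?in s \<and> ?inf s} \<in> events" using sin sinf by simp
  from zo show "\<P>(s in M. ?in s \<bar> ?inf s) \<in> {0, 1}"
  proof
    assume "AE \<omega> in signs p q. aperiodic \<omega> \<longrightarrow> \<Phi> \<omega>"
    from AE_M[OF this] pm have "AE s in M. ?in s \<and> ?inf s \<longleftrightarrow> ?inf s"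
      by eventually_elim (auto simp: \<Phi>_def dest: infinite_cluster_aperiodic)
    then have "prob {s \<in> space M. ?in s \<and> ?inf s} = prob {s \<in> space M. ?inf s}"
      by (intro prob_eq_AE sboth sinf)
    \<comment> \<open>The quotient has equal numerator and denominator: it is \<open>1\<close>, or
      \<open>0 / 0 = 0\<close> if the infinite cluster is a null event.\<close>
    then show ?thesis by (simp add: cond_prob_def)
  next
    assume "AE \<omega> in signs p q. aperiodic \<omega> \<longrightarrow> \<not> \<Phi> \<omega>"
    from AE_M[OF this] pm have "AE s in M. \<not> (?in s \<and> ?inf s)"
      by eventually_elim (auto simp: \<Phi>_def dest: infinite_cluster_aperiodic)
    then have "prob {s \<in> space M. ?in s \<and> ?inf s} = 0"
      using sboth by (subst prob_eq_0) (auto elim: eventually_mono)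
    then show ?thesis by (simp add: cond_prob_def)
  qed
qed

end
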